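(* Let $(X,d_X)$ and $(Y,d_Y)$ be unbounded chain-connected proper metric spaces. Let $T:\mathcal{SO}(X)\to\mathcal{SO}(Y)$ (resp. $T:\mathcal{SO}^{\ast}(X)\to\mathcal{SO}^{\ast}(Y)$) be a linear lattice isomorphism, and let $\omega=T(1)$. Then the homeomorphism $\tau:X\to Y$ induced by $T$ is a coarse homeomorphism such that $T=\omega\cdot(\tau^{-1})^{\ast}$, i.e. $T(f)=\omega\cdot(f\circ\tau^{-1})$ for every $f$ in the domain of $T$. In particular, $\omega\in\mathcal{SO}_{\sharp}(Y)$ (resp. $\omega\in\mathcal{SO}_{\sharp}^{\ast}(Y)$).
   Context: A metric space is proper if all its closed balls are compact. For $r>0$, $X$ is $r$-chain connected if for any $x,x'\in X$ there are finitely many points $p_0=x,p_1,\dots,p_n=x'$ in $X$ with $d_X(p_{i-1},p_i)\le r$ for $i=1,\dots,n$; $X$ is chain-connected if it is $r$-chain connected for some $r>0$. A continuous $f:X\to\mathbb{R}$ on a proper metric space is slowly oscillating if for every $R>0$ and $\varepsilon>0$ there is a compact $K\subset X$ with $\operatorname{diam} f(B_{d_X}(x,R))<\varepsilon$ for every $x\in X\setminus K$, where $B_{d_X}(x,R)$ is the closed ball. $\mathcal{SO}(X)$ is the vector lattice (pointwise $\wedge=\min$, $\vee=\max$) of all continuous slowly oscillating functions $X\to\mathbb{R}$ and $\mathcal{SO}^{\ast}(X)$ the sublattice of bounded ones. A linear lattice isomorphism is a linear bijection preserving $\vee$ and $\wedge$. For $A(X)$ equal to $\mathcal{SO}(X)$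 or $\mathcal{SO}^{\ast}(X)$, a homeomorphism $\tau:X\to Y$ is induced by a lattice isomorphism $T:A(X)\to A(Y)$ if for all $f,g\in A(X)$ and every open $U\subset X$: $f\ge g$ on $U$ iff $T(f)\ge T(g)$ on $\tau(U)$; such a $\tau$ exists and is unique, and it satisfies: $T(f)(y)=T(g)(y)$ iff $f(\tau^{-1}(y))=g(\tau^{-1}(y))$, for all $f,g\in A(X)$, $y\in Y$. A map $f:X\to Y$ is uniformly expansive if there is a non-decreasing $\sigma:[0,\infty)\to[0,\infty)$ with $d_Y(f(x),f(x'))\le\sigma(d_X(x,x'))$ for all $x,x'\in X$; metrically proper if preimages of bounded sets are bounded; a coarse map if it is both. A homeomorphism $f$ is a coarse homeomorphism if both $f$ and $f^{-1}$ are coarse maps. $\mathcal{SO}_{\sharp}(Y)$ is the set of $\omega\in\mathcal{SO}(Y)$ such that $\omega>0$ everywhere and, for every $f\in\mathcal{SO}(Y)$, $\omega\cdot f\in\mathcal{SO}(Y)$ and $(1/\omega)\cdot f\in\mathcal{SO}(Y)$. $\mathcal{SO}_{\sharp}^{\ast}(Y)$ is the set of $\omega\in\mathcal{SO}^{\ast}(Y)$ such that $\omega>0$ everywhere and, for every $f\in\mathcal{SO}^{\ast}(Y)$, $\omega\cdot f\in\mathcal{SO}^{\ast}(Y)$ and $(1/\omega)\cdot f\in\mathcal{SO}^{\ast}(Y)$. For a continuous map $h$, $h^{\ast}(f)=f\circ h$. *)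

theory Defs
  imports "HOL-Analysis.Analysis"
begin

text \<open>A metric space is a whole type of class \<^class>\<open>metric_space\<close>; properties of the space are
  predicates on the type.\<close>

definition proper_metric :: "'a::metric_space itself \<Rightarrow> bool" where
  "proper_metric _ \<longleftrightarrow> (\<forall>(x::'a) r. compact (cball x r))"

definition unbounded_metric :: "'a::metric_space itself \<Rightarrow> bool" where
  "unbounded_metric _ \<longleftrightarrow> \<not> bounded (UNIV :: 'a set)"

definition r_chain_connected :: "real \<Rightarrow> 'a::metric_space itself \<Rightarrow> bool" where
  "r_chain_connected r _ \<longleftrightarrow>
     (\<forall>x x'::'a. \<exists>(n::nat) p. p 0 = x \<and> p n = x' \<and> (\<forall>i\<in>{1..n}. dist (p (i - 1)) (p i) \<le> r))"

definition chain_connected :: "'a::metric_space itself \<Rightarrow> bool" where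
  "chain_connected X \<longleftrightarrow> (\<exists>r>0. r_chain_connected r X)"

text \<open>Intended for proper spaces only: there the image of a closed ball under a continuous map is
  bounded, so that \<^const>\<open>diameter\<close>, a real supremum, is the genuine diameter.\<close>

definition slowly_oscillating :: "('a::metric_space \<Rightarrow> real) \<Rightarrow> bool" where
  "slowly_oscillating f \<longleftrightarrow>
     continuous_on UNIV f \<and>
     (\<forall>R>0. \<forall>\<epsilon>>0. \<exists>K. compact K \<and> (\<forall>x. x \<notin> K \<longrightarrow> diameter (f ` cball x R) < \<epsilon>))"

definition SO :: "('a::metric_space \<Rightarrow> real) set" where
  "SO = {f. slowly_oscillating f}"

definition SO_bdd :: "('a::metric_space \<Rightarrow> real) set" where
  "SO_bdd = {f \<in> SO. bounded (range f)}"

text \<open>Lattices of functions are sets of functions with pointwise operations. The map \<open>T\<close> is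
  a total HOL function of which only the values on \<open>A\<close> matter.\<close>

definition linear_lattice_iso ::
  "('a \<Rightarrow> real) set \<Rightarrow> ('b \<Rightarrow> real) set \<Rightarrow> (('a \<Rightarrow> real) \<Rightarrow> ('b \<Rightarrow> real)) \<Rightarrow> bool" where
  "linear_lattice_iso A B T \<longleftrightarrow>
     bij_betw T A B \<and>
     (\<forall>f\<in>A. \<forall>g\<in>A. T (\<lambda>x. f x + g x) = (\<lambda>y. T f y + T g y)) \<and>
     (\<forall>c. \<forall>f\<in>A. T (\<lambda>x. c * f x) = (\<lambda>y. c * T f y)) \<and>
     (\<forall>f\<in>A. \<forall>g\<in>A. T (\<lambda>x. max (f x) (g x)) = (\<lambda>y. max (T f y) (T g y))) \<and>
     (\<forall>f\<in>A. \<forall>g\<in>A. T (\<lambda>x. min (f x) (g x)) = (\<lambda>y. min (T f y) (T g y)))"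

definition induced_homeomorphism ::
  "('a::metric_space \<Rightarrow> real) set \<Rightarrow> (('a \<Rightarrow> real) \<Rightarrow> ('b::metric_space \<Rightarrow> real)) \<Rightarrow> ('a \<Rightarrow> 'b) \<Rightarrow> bool"
where
  "induced_homeomorphism A T \<tau> \<longleftrightarrow>
     homeomorphism UNIV UNIV \<tau> (inv \<tau>) \<and>
     (\<forall>f\<in>A. \<forall>g\<in>A. \<forall>U. open U \<longrightarrow>
        ((\<forall>x\<in>U. f x \<ge> g x) \<longleftrightarrow> (\<forall>y\<in>\<tau> ` U. T f y \<ge> T g y)))"

definition uniformly_expansive :: "('a::metric_space \<Rightarrow> 'b::metric_space) \<Rightarrow> bool" where
  "uniformly_expansive f \<longleftrightarrow>
     (\<exists>\<sigma> :: real \<Rightarrow> real. mono_on {0..} \<sigma> \<and> (\<forall>t\<ge>0. \<sigma> t \<ge> 0) \<and>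
        (\<forall>x x'. dist (f x) (f x') \<le> \<sigma> (dist x x')))"

definition metrically_proper :: "('a::metric_space \<Rightarrow> 'b::metric_space) \<Rightarrow> bool" where
  "metrically_proper f \<longleftrightarrow> (\<forall>B. bounded B \<longrightarrow> bounded (f -` B))"

definition coarse_map :: "('a::metric_space \<Rightarrow> 'b::metric_space) \<Rightarrow> bool" where
  "coarse_map f \<longleftrightarrow> uniformly_expansive f \<and> metrically_proper f"

definition coarse_homeomorphism :: "('a::metric_space \<Rightarrow> 'b::metric_space) \<Rightarrow> bool" where
  "coarse_homeomorphism f \<longleftrightarrow>
     homeomorphism UNIV UNIV f (inv f) \<and> coarse_map f \<and> coarse_map (inv f)"

text \<open>\<open>sharp SO\<close> and \<open>sharp SO_bdd\<close> are the sets written with a subscript sharp sign.\<close>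

definition sharp :: "('a \<Rightarrow> real) set \<Rightarrow> ('a \<Rightarrow> real) set" where
  "sharp A = {\<omega> \<in> A. (\<forall>y. \<omega> y > 0) \<and>
     (\<forall>f\<in>A. (\<lambda>y. \<omega> y * f y) \<in> A \<and> (\<lambda>y. (1 / \<omega> y) * f y) \<in> A)}"

end

theory Submission
  imports Defs
begin

text \<open>For each point \<open>y\<close> of the target, \<open>f \<mapsto> T f y\<close> is a real-valued lattice homomorphism. By
  compactness, such a functional either is a multiple of the evaluation at a point or annihilates
  every function supported in a ball. In the second case it only sees behaviour at infinity, and the
  two lattices exclude this in different ways. A functional on \<open>SO\<close> takes finite values, but every
  slowly oscillating function \<open>f\<close> that tends to infinity is dominated by some slowly oscillating \<open>g\<close>
  with \<open>N f \<le> g + C\<^sub>N\<close> for all \<open>N\<close>, which forces the functional to be zero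
  (\<open>SO_functional_is_point_evaluation\<close>). On \<open>SO_bdd\<close> such functionals do exist, namely the points of
  the Higson corona, but none of them is \<open>f \<mapsto> T f y\<close>: the point \<open>y\<close> has a countable neighbourhood
  base, whereas a point of the corona cannot be pinned down by countably many functions, because
  two sequences that go to infinity and drift apart have subsequences, with common indices, that
  are separated by a bounded slowly oscillating function (\<open>SO_bdd_iso_is_point_evaluation\<close>).

  Hence \<open>T f = \<omega> (f \<circ> \<sigma>)\<close> with \<open>\<omega> = T 1 > 0\<close>. Applying the same to the inverse of \<open>T\<close> makes \<open>\<sigma>\<close> a
  homeomorphism with inverse \<open>\<tau>\<close>, and tent functions show that no other map is induced by \<open>T\<close>.

  For the coarse structure, all continuous functions vanishing at infinity are slowly oscillating, so
  \<open>\<omega> h\<close> is slowly oscillating for every such \<open>h\<close>. If \<open>\<omega>\<close> were unbounded, some such product would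
  take large values at points far out and the value zero at points a bounded distance away;
  chain-connectedness supplies those neighbouring points (\<open>bounded_weight\<close>). The inverse of \<open>T\<close> has
  weight \<open>1 / (\<omega> \<circ> \<tau>)\<close>, so \<open>\<omega>\<close> is also bounded away from zero. If \<open>\<tau>\<close> moved points at bounded distance
  arbitrarily far apart, a bounded slowly oscillating \<open>g\<close> separating their images would be pulled back
  to a function that keeps oscillating at infinity
  (\<open>uniformly_expansive_if_weighted_composition\<close>). Thus \<open>\<tau>\<close> and \<open>\<sigma>\<close> are coarse, composition with them
  carries each lattice into the other, and \<open>\<omega> g = T (g \<circ> \<tau>)\<close> and \<open>g / \<omega> = (T\<^sup>-\<^sup>1 g) \<circ> \<sigma>\<close> show
  that multiplication by \<open>\<omega>\<close> and by \<open>1 / \<omega>\<close> preserves the target lattice.\<close>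

section \<open>Slowly oscillating functions on a proper space\<close>

lemma bounded_range_real_iff: "bounded (range f) \<longleftrightarrow> (\<exists>B. \<forall>x. \<bar>f x :: real\<bar> \<le> B)"
  by (auto simp: bounded_iff)

lemma SO_continuous: "f \<in> SO \<Longrightarrow> continuous_on UNIV f"
  by (simp add: SO_def slowly_oscillating_def)

text \<open>In a proper space the compact sets and the bounded sets are cofinal in each other. Slow
  oscillation can therefore be tested far from a base point and on pairs of points, which makes all
  later estimates free of diameters.\<close>

lemma SO_iff:
  fixes f :: "'a::metric_space \<Rightarrow> real"
  assumes "proper_metric TYPE('a)"
  shows "f \<in> SO \<longleftrightarrow> continuous_on UNIV f \<and>
    (\<forall>R>0. \<forall>e>0. \<exists>M. \<forall>x x'. M < dist a x \<longrightarrow> dist x x' \<le> R \<longrightarrow> \<bar>f x - f x'\<bar> \<le> e)"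
    (is "_ \<longleftrightarrow> _ \<and> ?osc")
proof (intro iffI conjI)
  assume f: "f \<in> SO"
  then show cont: "continuous_on UNIV f" by (rule SO_continuous)
  show ?osc
  proof (intro allI impI)
    fix R e :: real assume "R > 0" "e > 0"
    then obtain K where K: "compact K" "\<And>x. x \<notin> K \<Longrightarrow> diameter (f ` cball x R) < e"
      using f unfolding SO_def slowly_oscillating_def by blast
    obtain M where M: "\<And>x. x \<in> K \<Longrightarrow> dist a x \<le> M"
      using compact_imp_bounded[OF K(1)] unfolding bounded_any_center[where a=a] by blast
    have "\<bar>f x - f x'\<bar> \<le> e" if "M < dist a x" "dist x x' \<le> R" for x x'
    proof -
      have "compact (f ` cball x R)"
        using assms cont by (intro compact_continuous_image)
          (auto simp: proper_metric_def intro: continuous_on_subset)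
      then have "dist (f x) (f x') \<le> diameter (f ` cball x R)"
        using that \<open>R > 0\<close> by (intro diameter_bounded_bound compact_imp_bounded) auto
      also have "\<dots> < e" using M[of x] that by (intro K(2)) auto
      finally show ?thesis by (simp add: dist_real_def)
    qed
    then show "\<exists>M. \<forall>x x'. M < dist a x \<longrightarrow> dist x x' \<le> R \<longrightarrow> \<bar>f x - f x'\<bar> \<le> e" by blast
  qed
next
  assume f: "continuous_on UNIV f \<and> ?osc"
  have "\<exists>K. compact K \<and> (\<forall>x. x \<notin> K \<longrightarrow> diameter (f ` cball x R) < e)"
    if "R > 0" "e > 0" for R e
  proof -
    have "e / 3 > 0" using that by simp
    then obtain M where M: "\<And>x x'. M < dist a x \<Longrightarrow> dist x x' \<le> R \<Longrightarrow> \<bar>f x - f x'\<bar> \<le> e / 3"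
      using f \<open>R > 0\<close> by meson
    have "diameter (f ` cball x R) < e" if "x \<notin> cball a M" for x
    proof -
      have "diameter (f ` cball x R) \<le> 2 * (e / 3)"
      proof (rule diameter_le)
        show "f ` cball x R \<noteq> {} \<or> 0 \<le> 2 * (e / 3)" using \<open>e > 0\<close> by simp
        fix s t assume "s \<in> f ` cball x R" "t \<in> f ` cball x R"
        then obtain s' t' where "s = f s'" "t = f t'" "dist x s' \<le> R" "dist x t' \<le> R" by auto
        moreover have "M < dist a x" using that by simp
        ultimately show "norm (s - t) \<le> 2 * (e / 3)"
          using M[of x s'] M[of x t'] by (simp add: dist_real_def[symmetric]) (smt (verit) dist_real_def)
      qed
      then show ?thesis using \<open>e > 0\<close> by simp
    qed
    then show ?thesis using assms unfolding proper_metric_def by blast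
  qed
  then show "f \<in> SO" using f by (simp add: SO_def slowly_oscillating_def)
qed

lemma SO_bdd_iff: "f \<in> SO_bdd \<longleftrightarrow> f \<in> SO \<and> (\<exists>B. \<forall>x. \<bar>f x\<bar> \<le> B)"
  by (simp add: SO_bdd_def bounded_range_real_iff)

lemma SO_bdd_subset: "SO_bdd \<subseteq> SO"
  by (auto simp: SO_bdd_def)

lemma SO_osc:
  fixes f :: "'a::metric_space \<Rightarrow> real"
  assumes "proper_metric TYPE('a)" "f \<in> SO" "R > 0" "e > 0"
  obtains M where "\<And>x x'. M < dist a x \<Longrightarrow> dist x x' \<le> R \<Longrightarrow> \<bar>f x - f x'\<bar> \<le> e"
  using assms SO_iff[OF assms(1), of f a] by meson

text \<open>The common form of all appeals to properness: a continuous map on a proper space sends balls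
  into balls.\<close>

lemma proper_bounded_image:
  fixes h :: "'a::metric_space \<Rightarrow> 'b::metric_space"
  assumes "proper_metric TYPE('a)" "continuous_on UNIV h"
  obtains Q where "\<And>x. dist a x \<le> M \<Longrightarrow> dist b (h x) \<le> Q"
proof -
  have "compact (h ` cball a M)"
    using assms by (intro compact_continuous_image)
      (auto simp: proper_metric_def intro: continuous_on_subset)
  then have "bounded (h ` cball a M)" by (rule compact_imp_bounded)
  then show thesis using that unfolding bounded_any_center[where a=b] by (metis imageI mem_cball)
qed

lemma proper_bounded_real:
  fixes h :: "'a::metric_space \<Rightarrow> real"
  assumes "proper_metric TYPE('a)" "continuous_on UNIV h"
  obtains Q where "\<And>x. dist a x \<le> M \<Longrightarrow> \<bar>h x\<bar> \<le> Q"
  using proper_bounded_image[OF assms, of a M 0] by auto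

text \<open>A function that vanishes at infinity oscillates slowly
  whatever its local behaviour is, so it may have arbitrarily narrow peaks.\<close>

lemma vanishing_at_infinity_in_SO_bdd:
  fixes h :: "'a::metric_space \<Rightarrow> real"
  assumes "proper_metric TYPE('a)" "continuous_on UNIV h"
    and small: "\<And>e. e > 0 \<Longrightarrow> \<exists>M. \<forall>x. M < dist a x \<longrightarrow> \<bar>h x\<bar> \<le> e"
  shows "h \<in> SO_bdd"
proof -
  have "h \<in> SO"
    unfolding SO_iff[OF assms(1), of h a]
  proof (intro conjI allI impI)
    fix R e :: real assume "R > 0" "e > 0"
    then obtain M where M: "\<And>x. M < dist a x \<Longrightarrow> \<bar>h x\<bar> \<le> e / 2" using small[of "e / 2"] by auto
    have "\<bar>h x - h x'\<bar> \<le> e" if "M + R < dist a x" "dist x x' \<le> R" for x x'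
    proof -
      have "M < dist a x'" using that dist_triangle[of a x x'] by (simp add: dist_commute)
      then show ?thesis using M[of x] M[of x'] that \<open>R > 0\<close> by simp
    qed
    then show "\<exists>M. \<forall>x x'. M < dist a x \<longrightarrow> dist x x' \<le> R \<longrightarrow> \<bar>h x - h x'\<bar> \<le> e" by blast
  qed (rule assms)
  moreover obtain M where M: "\<And>x. M < dist a x \<Longrightarrow> \<bar>h x\<bar> \<le> 1" using small[of 1] by auto
  moreover obtain Q where Q: "\<And>x. dist a x \<le> M \<Longrightarrow> \<bar>h x\<bar> \<le> Q"
    using proper_bounded_real[OF assms(1,2)] by blast
  have "\<bar>h x\<bar> \<le> max 1 Q" for x using M[of x] Q[of x] by (cases "dist a x \<le> M") auto
  ultimately show ?thesis unfolding SO_bdd_iff by blast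
qed

definition tent :: "'a::metric_space \<Rightarrow> real \<Rightarrow> 'a \<Rightarrow> real" where
  "tent p \<rho> x = max 0 (1 - dist x p / \<rho>)"

lemma tent_nonneg [simp]: "0 \<le> tent p \<rho> x" by (simp add: tent_def)
lemma tent_le_1: "\<rho> > 0 \<Longrightarrow> tent p \<rho> x \<le> 1" by (simp add: tent_def)
lemma tent_centre [simp]: "tent p \<rho> p = 1" by (simp add: tent_def)
lemma tent_eq_0_iff: "\<rho> > 0 \<Longrightarrow> tent p \<rho> x = 0 \<longleftrightarrow> \<rho> \<le> dist x p"
  by (simp add: tent_def max_def field_simps)

text \<open>The slope \<open>1 / \<rho>\<close> is what matters: tents of growing width oscillate less and less.\<close>

lemma tent_lipschitz:
  assumes "\<rho> > 0" shows "tent p \<rho> x \<le> tent p \<rho> x' + dist x x' / \<rho>"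
proof -
  have "dist x' p / \<rho> \<le> dist x p / \<rho> + dist x x' / \<rho>"
    using dist_triangle[of x' p x] assms
    by (simp add: add_divide_distrib[symmetric] divide_right_mono dist_commute)
  moreover have "0 \<le> dist x x' / \<rho>" using assms by simp
  ultimately show ?thesis unfolding tent_def by linarith
qed

lemma tent_continuous: "continuous_on S (tent p \<rho>)"
  unfolding tent_def divide_inverse by (intro continuous_intros)

lemma tent_in_SO_bdd:
  fixes p :: "'a::metric_space"
  assumes "proper_metric TYPE('a)" "\<rho> > 0"
  shows "tent p \<rho> \<in> SO_bdd"
proof (rule vanishing_at_infinity_in_SO_bdd[OF assms(1) tent_continuous, where a=p])
  fix e :: real assume "e > 0"
  then show "\<exists>M. \<forall>x. M < dist p x \<longrightarrow> \<bar>tent p \<rho> x\<bar> \<le> e"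
    using tent_eq_0_iff[OF assms(2), of p] by (intro exI[of _ \<rho>]) (metis abs_zero dist_commute less_imp_le)
qed

section \<open>Lattices of continuous functions and their functionals\<close>

text \<open>The common properties of \<open>SO\<close> and \<open>SO_bdd\<close> on which the duality between functionals and points
  rests.\<close>

locale function_lattice =
  fixes A :: "('a::metric_space \<Rightarrow> real) set"
  assumes one: "(\<lambda>_. 1) \<in> A"
    and add: "f \<in> A \<Longrightarrow> g \<in> A \<Longrightarrow> (\<lambda>x. f x + g x) \<in> A"
    and scale: "f \<in> A \<Longrightarrow> (\<lambda>x. c * f x) \<in> A"
    and max: "f \<in> A \<Longrightarrow> g \<in> A \<Longrightarrow> (\<lambda>x. max (f x) (g x)) \<in> A"
    and cont: "f \<in> A \<Longrightarrow> continuous_on UNIV f"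
begin

lemma const: "(\<lambda>_. c) \<in> A" using scale[OF one, of c] by simp

lemma diff: "f \<in> A \<Longrightarrow> g \<in> A \<Longrightarrow> (\<lambda>x. f x - g x) \<in> A"
  using add[of f "\<lambda>x. -1 * g x"] scale[of g "-1"] by simp

lemma abs: "f \<in> A \<Longrightarrow> (\<lambda>x. \<bar>f x\<bar>) \<in> A"
proof -
  assume f: "f \<in> A"
  have "(\<lambda>x. \<bar>f x\<bar>) = (\<lambda>x. max (f x) (-1 * f x))" by auto
  then show ?thesis using max[OF f scale[OF f, of "-1"]] by simp
qed

lemma min: "f \<in> A \<Longrightarrow> g \<in> A \<Longrightarrow> (\<lambda>x. min (f x) (g x)) \<in> A"
proof -
  assume "f \<in> A" "g \<in> A"
  then have "(\<lambda>x. f x + g x - max (f x) (g x)) \<in> A" by (intro diff add max)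
  moreover have "(\<lambda>x. f x + g x - max (f x) (g x)) = (\<lambda>x. min (f x) (g x))"
    by (auto simp: max_def min_def)
  ultimately show ?thesis by simp
qed

end

locale lattice_functional = function_lattice A
  for A :: "('a::metric_space \<Rightarrow> real) set" +
  fixes \<phi> :: "('a \<Rightarrow> real) \<Rightarrow> real"
  assumes functional_add: "f \<in> A \<Longrightarrow> g \<in> A \<Longrightarrow> \<phi> (\<lambda>x. f x + g x) = \<phi> f + \<phi> g"
    and functional_scale: "f \<in> A \<Longrightarrow> \<phi> (\<lambda>x. c * f x) = c * \<phi> f"
    and functional_max: "f \<in> A \<Longrightarrow> g \<in> A \<Longrightarrow> \<phi> (\<lambda>x. max (f x) (g x)) = max (\<phi> f) (\<phi> g)"
begin

lemma functional_const: "\<phi> (\<lambda>_. c) = c * \<phi> (\<lambda>_. 1)" using functional_scale[OF one, of c] by simp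

lemma functional_diff: "f \<in> A \<Longrightarrow> g \<in> A \<Longrightarrow> \<phi> (\<lambda>x. f x - g x) = \<phi> f - \<phi> g"
  using functional_add[of f "\<lambda>x. -1 * g x"] functional_scale[of g "-1"] scale[of g "-1"] by simp

lemma functional_mono: "f \<in> A \<Longrightarrow> g \<in> A \<Longrightarrow> (\<And>x. f x \<le> g x) \<Longrightarrow> \<phi> f \<le> \<phi> g"
  using functional_max[of f g] by (simp add: max_absorb2)

lemma functional_abs: "f \<in> A \<Longrightarrow> \<phi> (\<lambda>x. \<bar>f x\<bar>) = \<bar>\<phi> f\<bar>"
proof -
  assume f: "f \<in> A"
  have "(\<lambda>x. \<bar>f x\<bar>) = (\<lambda>x. max (f x) (-1 * f x))" by auto
  then show ?thesis using functional_max[OF f scale[OF f, of "-1"]] functional_scale[OF f, of "-1"] by auto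
qed

text \<open>If every point of \<open>K\<close> had a kernel element that does not vanish there, finitely many of
  them would add up, after taking absolute values, to a kernel element \<open>F\<close> that is positive on \<open>K\<close>;
  then \<open>\<bar>f\<bar> \<le> C F\<close> would put \<open>f\<close> in the kernel. So the kernel lies in that of the evaluation at
  some point, and two functionals with nested kernels are proportional.\<close>

lemma point_evaluation_if_nonzero_on_compact:
  assumes "compact K" and f: "f \<in> A" "\<And>x. x \<notin> K \<Longrightarrow> f x = 0" "\<phi> f \<noteq> 0"
  shows "\<exists>x c. \<forall>g\<in>A. \<phi> g = c * g x"
proof -
  have "\<exists>x\<in>K. \<forall>g\<in>A. \<phi> g = 0 \<longrightarrow> g x = 0"
  proof (rule ccontr)
    assume "\<not> ?thesis"
    then obtain G where G: "\<And>x. x \<in> K \<Longrightarrow> G x \<in> A \<and> \<phi> (G x) = 0 \<and> G x x \<noteq> 0" by metis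
    define U where "U x = {z. G x z \<noteq> 0}" for x
    have "open (U x)" if "x \<in> K" for x
    proof -
      have "continuous_on UNIV (G x)" using G that cont by blast
      then have "open (G x -` (- {0}))" by (intro open_vimage) auto
      moreover have "U x = G x -` (- {0})" by (auto simp: U_def)
      ultimately show ?thesis by simp
    qed
    moreover have "K \<subseteq> (\<Union>x\<in>K. U x)" using G by (auto simp: U_def)
    ultimately obtain D where D: "D \<subseteq> K" "finite D" "K \<subseteq> (\<Union>x\<in>D. U x)"
      using compactE_image[OF assms(1), of K U] by metis
    define F where "F z = (\<Sum>x\<in>D. \<bar>G x z\<bar>)" for z
    have F: "F \<in> A" "\<phi> F = 0"
    proof -
      have "(\<lambda>z. \<Sum>x\<in>D. \<bar>G x z\<bar>) \<in> A \<and> \<phi> (\<lambda>z. \<Sum>x\<in>D. \<bar>G x z\<bar>) = 0"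
        using D(2,1)
      proof induction
        case empty
        show ?case using const[of 0] functional_const[of 0] by simp
      next
        case (insert x D)
        then have "G x \<in> A" "\<phi> (G x) = 0" using G by auto
        with insert show ?case
          using add[OF abs[of "G x"]] functional_add[OF abs[of "G x"]] functional_abs[of "G x"] by simp
      qed
      then show "F \<in> A" "\<phi> F = 0" by (simp_all add: F_def[abs_def])
    qed
    have Fpos: "F z > 0" if zK: "z \<in> K" for z
    proof -
      obtain x where "x \<in> D" "G x z \<noteq> 0" using D(3) zK unfolding U_def by blast
      then show ?thesis unfolding F_def using D(2) by (intro sum_pos2[of D x]) auto
    qed
    have F0: "F z \<ge> 0" for z by (simp add: F_def sum_nonneg)
    have "continuous_on K (\<lambda>z. f z / F z)"
      using cont[OF f(1)] cont[OF F(1)] Fpos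
      by (intro continuous_on_divide) (auto intro: continuous_on_subset simp: less_imp_neq[symmetric] dest: Fpos)
    then have "bounded ((\<lambda>z. f z / F z) ` K)"
      using assms(1) by (intro compact_imp_bounded compact_continuous_image)
    then obtain C where C: "\<And>z. z \<in> K \<Longrightarrow> \<bar>f z / F z\<bar> \<le> C" unfolding bounded_iff by auto
    have "\<bar>f z\<bar> \<le> C * F z" for z
    proof (cases "z \<in> K")
      case True
      then show ?thesis using C[OF True] Fpos[OF True] by (simp add: abs_divide field_simps)
    next
      case False
      moreover have "C \<ge> 0"
      proof -
        have "K \<noteq> {}"
        proof
          assume "K = {}"
          then have "f = (\<lambda>_. 0)" using f(2) by auto
          then show False using f(3) functional_const[of 0] by simp
        qed
        then obtain z where "z \<in> K" by blast
        from C[OF this] show ?thesis by linarith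
      qed
      ultimately show ?thesis using f(2) F0 by simp
    qed
    then have "\<phi> (\<lambda>z. \<bar>f z\<bar>) \<le> \<phi> (\<lambda>z. C * F z)" using f F by (intro functional_mono abs scale) auto
    then show False using functional_abs[OF f(1)] functional_scale[OF F(1)] F(2) f(3) by simp
  qed
  then obtain x where x: "\<And>g. g \<in> A \<Longrightarrow> \<phi> g = 0 \<Longrightarrow> g x = 0" by blast
  have eq: "g x * \<phi> f = \<phi> g * f x" if g: "g \<in> A" for g
  proof -
    have "(\<lambda>z. \<phi> f * g z - \<phi> g * f z) \<in> A" using f g by (intro diff scale)
    moreover have "\<phi> (\<lambda>z. \<phi> f * g z - \<phi> g * f z) = 0"
      using functional_diff[OF scale[OF g] scale[OF f(1)]] functional_scale[OF g] functional_scale[OF f(1)] by simp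
    ultimately have "\<phi> f * g x - \<phi> g * f x = 0" by (rule x)
    then show ?thesis by (simp add: mult.commute)
  qed
  have "f x \<noteq> 0" using eq[OF one] f(3) by auto
  then have "\<phi> g = \<phi> f / f x * g x" if "g \<in> A" for g using eq[OF that] by (simp add: field_simps)
  then show ?thesis by blast
qed

corollary tent_null_if_not_point_evaluation:
  assumes "proper_metric TYPE('a)" "tent a r \<in> A" "r > 0"
    and not_point: "\<not> (\<exists>x c. \<forall>g\<in>A. \<phi> g = c * g x)"
  shows "\<phi> (tent a r) = 0"
proof (rule ccontr)
  assume "\<phi> (tent a r) \<noteq> 0"
  moreover have "tent a r x = 0" if "x \<notin> cball a r" for x
    using that tent_eq_0_iff[OF assms(3), of a x] by (simp add: dist_commute)
  ultimately show False
    using point_evaluation_if_nonzero_on_compact[of "cball a r"] assms by (auto simp: proper_metric_def)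
qed

end

lemma function_lattice_SO:
  assumes "proper_metric TYPE('a::metric_space)"
  shows "function_lattice (SO :: ('a \<Rightarrow> real) set)"
proof
  note iff = SO_iff[OF assms, where a=undefined]
  show "(\<lambda>_. 1) \<in> (SO :: ('a \<Rightarrow> real) set)" unfolding iff by auto
  fix f g :: "'a \<Rightarrow> real" and c :: real
  assume f: "f \<in> SO"
  show cont: "continuous_on UNIV f" by (rule SO_continuous[OF f])
  show "(\<lambda>x. c * f x) \<in> SO" unfolding iff
  proof (intro conjI allI impI)
    show "continuous_on UNIV (\<lambda>x. c * f x)" by (intro continuous_intros cont)
    fix R e :: real assume "R > 0" "e > 0"
    then have "e / (\<bar>c\<bar> + 1) > 0" by simp
    then obtain M where M: "\<And>x x'. M < dist undefined x \<Longrightarrow> dist x x' \<le> R \<Longrightarrow> \<bar>f x - f x'\<bar> \<le> e / (\<bar>c\<bar> + 1)"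
      using SO_osc[OF assms f \<open>R > 0\<close>] by blast
    have "\<bar>c * f x - c * f x'\<bar> \<le> e" if "M < dist undefined x" "dist x x' \<le> R" for x x'
    proof -
      have "\<bar>c * f x - c * f x'\<bar> = \<bar>c\<bar> * \<bar>f x - f x'\<bar>" by (simp add: abs_mult[symmetric] algebra_simps)
      also have "\<dots> \<le> (\<bar>c\<bar> + 1) * (e / (\<bar>c\<bar> + 1))" using M[OF that] by (intro mult_mono) auto
      finally show ?thesis by simp
    qed
    then show "\<exists>M. \<forall>x x'. M < dist undefined x \<longrightarrow> dist x x' \<le> R \<longrightarrow> \<bar>c * f x - c * f x'\<bar> \<le> e" by blast
  qed
  assume g: "g \<in> SO"
  have both: "\<exists>M. \<forall>x x'. M < dist undefined x \<longrightarrow> dist x x' \<le> R \<longrightarrow> \<bar>f x - f x'\<bar> \<le> e / 2 \<and> \<bar>g x - g x'\<bar> \<le> e / 2"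
    if "R > 0" "e > 0" for R e
  proof -
    have "e / 2 > 0" using that by simp
    obtain M1 where M1: "\<And>x x'. M1 < dist undefined x \<Longrightarrow> dist x x' \<le> R \<Longrightarrow> \<bar>f x - f x'\<bar> \<le> e / 2"
      using SO_osc[OF assms f \<open>R > 0\<close> \<open>e / 2 > 0\<close>] by blast
    obtain M2 where M2: "\<And>x x'. M2 < dist undefined x \<Longrightarrow> dist x x' \<le> R \<Longrightarrow> \<bar>g x - g x'\<bar> \<le> e / 2"
      using SO_osc[OF assms g \<open>R > 0\<close> \<open>e / 2 > 0\<close>] by blast
    show ?thesis using M1 M2 by (intro exI[of _ "max M1 M2"]) auto
  qed
  show "(\<lambda>x. f x + g x) \<in> SO" unfolding iff
  proof (intro conjI allI impI)
    show "continuous_on UNIV (\<lambda>x. f x + g x)" by (intro continuous_intros cont SO_continuous[OF g])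
    fix R e :: real assume "R > 0" "e > 0"
    then obtain M where M: "\<And>x x'. M < dist undefined x \<Longrightarrow> dist x x' \<le> R \<Longrightarrow>
        \<bar>f x - f x'\<bar> \<le> e / 2 \<and> \<bar>g x - g x'\<bar> \<le> e / 2" using both by meson
    have "\<bar>f x + g x - (f x' + g x')\<bar> \<le> e" if "M < dist undefined x" "dist x x' \<le> R" for x x'
      using M[OF that] abs_triangle_ineq[of "f x - f x'" "g x - g x'"] by (simp add: algebra_simps)
    then show "\<exists>M. \<forall>x x'. M < dist undefined x \<longrightarrow> dist x x' \<le> R \<longrightarrow> \<bar>f x + g x - (f x' + g x')\<bar> \<le> e" by blast
  qed
  show "(\<lambda>x. max (f x) (g x)) \<in> SO" unfolding iff
  proof (intro conjI allI impI)
    show "continuous_on UNIV (\<lambda>x. max (f x) (g x))" by (intro continuous_intros cont SO_continuous[OF g])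
    fix R e :: real assume "R > 0" "e > 0"
    then obtain M where M: "\<And>x x'. M < dist undefined x \<Longrightarrow> dist x x' \<le> R \<Longrightarrow>
        \<bar>f x - f x'\<bar> \<le> e / 2 \<and> \<bar>g x - g x'\<bar> \<le> e / 2" using both by meson
    have "\<bar>max (f x) (g x) - max (f x') (g x')\<bar> \<le> e" if "M < dist undefined x" "dist x x' \<le> R" for x x'
      using conjunct1[OF M[OF that]] conjunct2[OF M[OF that]] \<open>e > 0\<close> by linarith
    then show "\<exists>M. \<forall>x x'. M < dist undefined x \<longrightarrow> dist x x' \<le> R \<longrightarrow> \<bar>max (f x) (g x) - max (f x') (g x')\<bar> \<le> e" by blast
  qed
qed

lemma function_lattice_SO_bdd:
  assumes "proper_metric TYPE('a::metric_space)"
  shows "function_lattice (SO_bdd :: ('a \<Rightarrow> real) set)"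
proof -
  interpret SO: function_lattice "SO :: ('a \<Rightarrow> real) set" by (rule function_lattice_SO[OF assms])
  show ?thesis
  proof
    fix f g :: "'a \<Rightarrow> real" and c :: real
    show "(\<lambda>_. 1) \<in> (SO_bdd :: ('a \<Rightarrow> real) set)" using SO.one by (auto simp: SO_bdd_iff)
    assume "f \<in> SO_bdd"
    then obtain B where f: "f \<in> SO" "\<And>x. \<bar>f x\<bar> \<le> B" by (auto simp: SO_bdd_iff)
    show "continuous_on UNIV f" using f SO_continuous by blast
    have "\<bar>c * f x\<bar> \<le> \<bar>c\<bar> * B" for x using f(2)[of x] by (simp add: abs_mult mult_left_mono)
    then show "(\<lambda>x. c * f x) \<in> SO_bdd" using SO.scale[OF f(1)] by (auto simp: SO_bdd_iff)
    assume "g \<in> SO_bdd"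
    then obtain C where g: "g \<in> SO" "\<And>x. \<bar>g x\<bar> \<le> C" by (auto simp: SO_bdd_iff)
    have "\<bar>f x + g x\<bar> \<le> B + C" for x using f(2)[of x] g(2)[of x] by simp
    then show "(\<lambda>x. f x + g x) \<in> SO_bdd" using SO.add[OF f(1) g(1)] by (auto simp: SO_bdd_iff)
    have "\<bar>max (f x) (g x)\<bar> \<le> max B C" for x using f(2)[of x] g(2)[of x] by (auto simp: max_def)
    then show "(\<lambda>x. max (f x) (g x)) \<in> SO_bdd" using SO.max[OF f(1) g(1)] by (auto simp: SO_bdd_iff)
  qed
qed


section \<open>Lattice functionals on the unbounded lattice\<close>

text \<open>The standard slowly oscillating function that tends to infinity: the logarithm turns a
  bounded change of a large distance into a small change.\<close>

lemma log_growth_in_SO: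
  fixes a :: "'a::metric_space"
  assumes "proper_metric TYPE('a)"
  shows "(\<lambda>x. ln (1 + dist a x)) \<in> SO"
  unfolding SO_iff[OF assms, of _ a]
proof (intro conjI allI impI)
  show "continuous_on UNIV (\<lambda>x. ln (1 + dist a x))"
    by (intro continuous_intros) (smt (verit) zero_le_dist)
  fix R e :: real assume R: "R > 0" "e > 0"
  \<comment> \<open>Beyond \<open>v > R / e\<close> adding \<open>R\<close> multiplies \<open>1 + v\<close> by less than \<open>1 + e\<close>.\<close>
  have one_side: "ln (1 + u) - ln (1 + v) \<le> e"
    if "v \<ge> 0" "v > R / e" "u \<ge> 0" "u \<le> v + R" for u v :: real
  proof -
    have "ln (1 + u) \<le> ln ((1 + v) * (1 + e))"
    proof (rule ln_mono)
      have "R < v * e" using that R by (simp add: field_simps)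
      then show "1 + u \<le> (1 + v) * (1 + e)" using that R by (simp add: algebra_simps)
    qed (use that in auto)
    also have "\<dots> = ln (1 + v) + ln (1 + e)" using that R by (intro ln_mult_pos) auto
    also have "ln (1 + e) \<le> e" using R by (intro ln_add_one_self_le_self) auto
    finally show ?thesis by simp
  qed
  show "\<exists>M. \<forall>x x'. M < dist a x \<longrightarrow> dist x x' \<le> R \<longrightarrow> \<bar>ln (1 + dist a x) - ln (1 + dist a x')\<bar> \<le> e"
  proof (intro exI allI impI)
    fix x x' assume x: "R / e + R < dist a x" "dist x x' \<le> R"
    have "dist a x \<le> dist a x' + R" "dist a x' \<le> dist a x + R"
      using x dist_triangle[of a x x'] dist_triangle[of a x' x] by (auto simp: dist_commute)
    then show "\<bar>ln (1 + dist a x) - ln (1 + dist a x')\<bar> \<le> e"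
      using x R one_side[of "dist a x" "dist a x'"] one_side[of "dist a x'" "dist a x"]
      by (auto simp: abs_le_iff)
  qed
qed

text \<open>The function \<open>g\<close> is \<open>\<Theta> \<circ> f\<close> for the convex function \<open>\<Theta> u = (\<Sum>n. max 0 (u - t n))\<close>, whose
  slope tends to infinity. If the thresholds \<open>t n\<close> are far enough apart, the slope is only about \<open>n\<close>
  where \<open>f\<close> oscillates by at most \<open>1 / n\<^sup>2\<close>, so that \<open>\<Theta> \<circ> f\<close> still oscillates by at most about
  \<open>1 / n\<close>.\<close>

lemma superlinear_in_SO:
  fixes f :: "'a::metric_space \<Rightarrow> real"
  assumes proper: "proper_metric TYPE('a)" and f: "f \<in> SO"
    and unb: "\<And>t. \<exists>M. \<forall>x. M < dist a x \<longrightarrow> t \<le> f x"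
  shows "\<exists>g\<in>SO. \<forall>N::nat. \<exists>C. \<forall>x. real N * f x \<le> g x + C"
proof -
  have "\<exists>t. \<forall>x x'. t \<le> f x + 1 \<longrightarrow> dist x x' \<le> real n + 1 \<longrightarrow> \<bar>f x - f x'\<bar> \<le> 1 / (real n + 1)^2" for n :: nat
  proof -
    obtain M where M: "\<And>x x'. M < dist a x \<Longrightarrow> dist x x' \<le> real n + 1 \<Longrightarrow> \<bar>f x - f x'\<bar> \<le> 1 / (real n + 1)^2"
    proof -
      have "real n + 1 > 0" "1 / (real n + 1)^2 > 0" by auto
      then show thesis using SO_osc[OF proper f] that by blast
    qed
    obtain Q where Q: "\<And>x. dist a x \<le> M \<Longrightarrow> \<bar>f x\<bar> \<le> Q"
      using proper_bounded_real[OF proper SO_continuous[OF f]] by blast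
    have "M < dist a x" if "Q + 2 \<le> f x + 1" for x using Q[of x] that by fastforce
    then show ?thesis using M by blast
  qed
  then obtain s where s: "\<And>n x x'. s n \<le> f x + 1 \<Longrightarrow> dist x x' \<le> real n + 1 \<Longrightarrow> \<bar>f x - f x'\<bar> \<le> 1 / (real n + 1)^2"
    by metis
  \<comment> \<open>The bound \<open>n \<le> t n\<close> makes the sum defining \<open>\<Theta>\<close> locally finite.\<close>
  define t where "t n = max (s n) (real n)" for n
  have t: "real n \<le> t n" "\<And>x x'. t n \<le> f x + 1 \<Longrightarrow> dist x x' \<le> real n + 1 \<Longrightarrow> \<bar>f x - f x'\<bar> \<le> 1 / (real n + 1)^2" for n
    using s[of n] by (auto simp: t_def)
  define \<Theta> where "\<Theta> u = (\<Sum>n<nat \<lceil>u\<rceil>. max 0 (u - t n))" for u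
  have Theta: "\<Theta> u = (\<Sum>n<K. max 0 (u - t n))" if "u \<le> real K" for u K
  proof -
    have "nat \<lceil>u\<rceil> \<le> K" using that by (simp add: nat_le_iff ceiling_le_iff)
    moreover have "max 0 (u - t n) = 0" if "n \<in> {..<K} - {..<nat \<lceil>u\<rceil>}" for n
    proof -
      have "nat \<lceil>u\<rceil> \<le> n" using that by simp
      then have "u \<le> real n" by linarith
      then show ?thesis using t(1)[of n] by simp
    qed
    ultimately show ?thesis unfolding \<Theta>_def by (intro sum.mono_neutral_left ballI) blast+
  qed
  have "continuous_on UNIV \<Theta>"
  proof -
    have "continuous_on (\<Union>K::nat. {..<real K}) \<Theta>"
    proof (rule continuous_on_open_UN)
      fix K :: nat
      have "continuous_on {..<real K} (\<lambda>u. \<Sum>n<K. max 0 (u - t n))" by (intro continuous_intros)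
      then show "continuous_on {..<real K} \<Theta>" using Theta by (subst continuous_on_cong[OF refl]) auto
    qed auto
    moreover have "(\<Union>K::nat. {..<real K}) = UNIV" using reals_Archimedean2 by auto
    ultimately show ?thesis by simp
  qed
  then have contg: "continuous_on UNIV (\<lambda>x. \<Theta> (f x))"
    by (rule continuous_on_compose2[OF _ SO_continuous[OF f]]) auto
  have "(\<lambda>x. \<Theta> (f x)) \<in> SO"
    unfolding SO_iff[OF proper, of _ a]
  proof (intro conjI allI impI contg)
    fix R e :: real assume R: "R > 0" "e > 0"
    obtain N where N: "real N \<ge> R" "real N \<ge> 1 / e"
      using real_arch_simple[of "max R (1/e)"] by auto
    obtain M where M: "\<And>x. M < dist a x \<Longrightarrow> t N \<le> f x" using unb by blast
    have "\<bar>\<Theta> (f x) - \<Theta> (f x')\<bar> \<le> e" if x: "M < dist a x" "dist x x' \<le> R" for x x'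
    proof -
      define J where "J = {n. t n \<le> f x + 1}"
      have "J \<subseteq> {..nat \<lceil>f x + 1\<rceil>}"
      proof
        fix n assume "n \<in> J"
        then have "real n \<le> f x + 1" using t(1)[of n] by (simp add: J_def)
        then show "n \<in> {..nat \<lceil>f x + 1\<rceil>}" by simp linarith
      qed
      then have fin: "finite J" by (rule finite_subset) simp
      have "N \<in> J" using M[OF x(1)] by (simp add: J_def)
      \<comment> \<open>The terms beyond \<open>k\<close> vanish at both points: the margin \<open>1\<close> in \<open>J\<close> absorbs the oscillation
        of \<open>f\<close>. Each of the \<open>k + 1\<close> remaining terms changes by at most \<open>1 / (k + 1)\<^sup>2\<close>.\<close>
      define k where "k = Max J"
      have k: "k \<in> J" "N \<le> k" "\<And>n. n \<in> J \<Longrightarrow> n \<le> k"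
        using fin \<open>N \<in> J\<close> by (auto simp: k_def intro: Max_in Max_ge)
      have d: "\<bar>f x - f x'\<bar> \<le> 1 / (real k + 1)^2"
        using k x N by (intro t(2)) (auto simp: J_def)
      also have "\<dots> \<le> 1" by simp
      finally have d1: "\<bar>f x - f x'\<bar> \<le> 1" .
      obtain K :: nat where K: "f x + 1 \<le> K" "k < K"
        using real_arch_simple[of "max (f x + 1) (real k + 1)"] by auto
      have "\<Theta> (f x) - \<Theta> (f x') = (\<Sum>n<K. max 0 (f x - t n) - max 0 (f x' - t n))"
        using K d1 Theta[of "f x" K] Theta[of "f x'" K] by (simp add: sum_subtractf)
      also have "\<dots> = (\<Sum>n\<le>k. max 0 (f x - t n) - max 0 (f x' - t n))"
      proof (rule sum.mono_neutral_right)
        show "\<forall>n\<in>{..<K} - {..k}. max 0 (f x - t n) - max 0 (f x' - t n) = 0"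
        proof
          fix n assume "n \<in> {..<K} - {..k}"
          then have "n \<notin> J" using k(3)[of n] by auto
          then show "max 0 (f x - t n) - max 0 (f x' - t n) = 0" using d1 by (auto simp: J_def)
        qed
      qed (use K in auto)
      also have "\<bar>\<dots>\<bar> \<le> (\<Sum>n\<le>k. \<bar>max 0 (f x - t n) - max 0 (f x' - t n)\<bar>)" by (rule sum_abs)
      also have "\<dots> \<le> (\<Sum>n\<le>k. 1 / (real k + 1)^2)"
      proof (rule sum_mono)
        fix n show "\<bar>max 0 (f x - t n) - max 0 (f x' - t n)\<bar> \<le> 1 / (real k + 1)^2" using d by linarith
      qed
      also have "\<dots> = 1 / (real k + 1)" by (simp add: power2_eq_square add.commute)
      also have "\<dots> \<le> e"
      proof -
        have "1 / e \<le> real k + 1" using k(2) N(2) by linarith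
        then show ?thesis using R by (simp add: field_simps)
      qed
      finally show ?thesis by simp
    qed
    then show "\<exists>M. \<forall>x x'. M < dist a x \<longrightarrow> dist x x' \<le> R \<longrightarrow> \<bar>\<Theta> (f x) - \<Theta> (f x')\<bar> \<le> e" by blast
  qed
  moreover have "real N * f x \<le> \<Theta> (f x) + (\<Sum>n<N. t n)" for N x
  proof -
    obtain K :: nat where K: "f x \<le> K" "N \<le> K"
      using real_arch_simple[of "max (f x) (real N)"] by auto
    have "real N * f x - (\<Sum>n<N. t n) = (\<Sum>n<N. f x - t n)" by (simp add: sum_subtractf)
    also have "\<dots> \<le> (\<Sum>n<N. max 0 (f x - t n))" by (intro sum_mono) simp
    also have "\<dots> \<le> (\<Sum>n<K. max 0 (f x - t n))" using K by (intro sum_mono2) auto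
    also have "\<dots> = \<Theta> (f x)" using Theta K by simp
    finally show ?thesis by simp
  qed
  ultimately show ?thesis by (intro bexI[of _ "\<lambda>x. \<Theta> (f x)"]) blast+
qed

lemma nonpos_if_multiples_bounded:
  fixes u v :: real
  assumes "\<And>N::nat. real N * u \<le> v"
  shows "u \<le> 0"
  using assms reals_Archimedean3[of u] by (meson leD leI)

text \<open>Otherwise \<open>\<phi>\<close> annihilates the tents. Let \<open>f \<ge> \<bar>h\<bar>\<close> tend to infinity. Up to a multiple of a
  tent, \<open>N\<close> lies below \<open>f\<close>, so \<open>N \<phi>(1) \<le> \<phi>(f)\<close> for all \<open>N\<close> and \<open>\<phi>(1) = 0\<close>. With this, a superlinear
  majorant \<open>g\<close> gives \<open>N \<phi>(f) \<le> \<phi>(g)\<close> for all \<open>N\<close>, so \<open>\<phi>(f) = 0\<close> and \<open>\<phi>(h) = 0\<close>.\<close>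

lemma SO_functional_is_point_evaluation:
  assumes proper: "proper_metric TYPE('a::metric_space)"
    and "lattice_functional SO \<phi>" and h: "h \<in> SO" "\<phi> h \<noteq> 0"
  shows "\<exists>(x::'a) c. \<forall>g\<in>SO. \<phi> g = c * g x"
proof (rule ccontr)
  assume not_point: "\<not> ?thesis"
  interpret lattice_functional SO \<phi> by fact
  define a :: 'a where "a = undefined"
  have tent0: "\<phi> (tent a r) = 0" if "r > 0" for r
    using tent_null_if_not_point_evaluation[OF proper _ that not_point] tent_in_SO_bdd[OF proper that] SO_bdd_subset
    by blast
  define f where "f x = \<bar>h x\<bar> + ln (1 + dist a x)" for x
  have f: "f \<in> SO" unfolding f_def[abs_def] by (intro add abs h log_growth_in_SO[OF proper])
  have unb: "\<exists>M. \<forall>x. M < dist a x \<longrightarrow> t \<le> f x" for t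
  proof (intro exI allI impI)
    fix x assume "exp t < dist a x"
    then have "t < ln (1 + dist a x)" using exp_gt_zero[of t]
      by (smt (verit) exp_less_cancel_iff exp_ln)
    then show "t \<le> f x" by (simp add: f_def)
  qed
  have "\<phi> (\<lambda>_. 1) \<le> 0"
  proof (rule nonpos_if_multiples_bounded)
    fix N :: nat
    obtain M where M: "\<And>x. M < dist a x \<Longrightarrow> real N \<le> f x" using unb by blast
    define r where "r = 2 * max 1 M"
    have r: "r > 0" "tent a r \<in> SO" using tent_in_SO_bdd[OF proper, of r a] by (auto simp: r_def SO_bdd_iff)
    have "real N \<le> f x + 2 * real N * tent a r x" for x
    proof (cases "M < dist a x")
      case True
      then show ?thesis using M[OF True] by (simp add: add_increasing2)
    next
      case False
      then have "1/2 \<le> tent a r x" using r(1) by (simp add: tent_def r_def dist_commute field_simps max_def)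
      then have "real N * 1 \<le> real N * (2 * tent a r x)" by (intro mult_left_mono) auto
      moreover have "0 \<le> f x" by (simp add: f_def)
      ultimately show ?thesis by (simp add: algebra_simps)
    qed
    then have "\<phi> (\<lambda>_. real N) \<le> \<phi> (\<lambda>x. f x + 2 * real N * tent a r x)"
      by (intro functional_mono const add f scale r)
    also have "\<dots> = \<phi> f" using functional_add[OF f scale[OF r(2)]] functional_scale[OF r(2)] tent0[OF r(1)] by simp
    finally show "real N * \<phi> (\<lambda>_. 1) \<le> \<phi> f" using functional_const[of "real N"] by simp
  qed
  moreover have "0 \<le> \<phi> (\<lambda>_. 1)" using functional_mono[OF const[of 0] one] functional_const[of 0] by simp
  ultimately have phi1: "\<phi> (\<lambda>_. 1) = 0" by simp
  obtain g where g: "g \<in> SO" "\<And>N::nat. \<exists>C. \<forall>x. real N * f x \<le> g x + C"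
    using superlinear_in_SO[OF proper f unb] by blast
  have "\<phi> f \<le> 0"
  proof (rule nonpos_if_multiples_bounded)
    fix N :: nat
    obtain C where "\<And>x. real N * f x \<le> g x + C" using g(2) by blast
    then have "\<phi> (\<lambda>x. real N * f x) \<le> \<phi> (\<lambda>x. g x + C)" by (intro functional_mono scale add const f g(1))
    then show "real N * \<phi> f \<le> \<phi> g"
      using functional_scale[OF f] functional_add[OF g(1) const] functional_const[of C] phi1 by simp
  qed
  moreover have "\<phi> (\<lambda>x. \<bar>h x\<bar>) \<le> \<phi> f" by (intro functional_mono abs h f) (simp add: f_def)
  ultimately show False using functional_abs[OF h(1)] h(2) by simp
qed

section \<open>Functions separating two sequences that go to infinity\<close>

text \<open>The pairs are chosen recursively, each one farther from \<open>a\<close> than all previous ones by the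
  required separation. Hence only the two points of one pair can be close, and for these the
  separation is assumed.\<close>

lemma sparse_pairs:
  fixes a :: "'a::metric_space" and \<rho> :: "nat \<Rightarrow> real"
  assumes far: "\<And>n M. \<exists>x x'. M < dist a x \<and> M < dist a x' \<and> \<rho> n \<le> dist x x' \<and> P n x x'"
    and \<rho>: "mono \<rho>" "\<And>n. 0 \<le> \<rho> n"
  obtains p q where "\<And>n. P n (p n) (q n)" "\<And>n. real n < dist a (p n)"
    "\<And>m n. \<rho> n \<le> dist (q m) (p n)"
proof -
  define top where "top z = max (dist a (fst z)) (dist a (snd z))" for z :: "'a \<times> 'a"
  define low where "low z = min (dist a (fst z)) (dist a (snd z))" for z :: "'a \<times> 'a"
  define Q where "Q n z \<longleftrightarrow> real n < low z \<and> \<rho> n \<le> dist (fst z) (snd z) \<and> P n (fst z) (snd z)" for n z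
  have ex: "\<exists>z. Q n z \<and> M \<le> low z" for n M
  proof -
    obtain x x' where "max (real n) M < dist a x" "max (real n) M < dist a x'" "\<rho> n \<le> dist x x'" "P n x x'"
      using far by blast
    then have "Q n (x, x') \<and> M \<le> low (x, x')" by (simp add: Q_def low_def)
    then show ?thesis by blast
  qed
  obtain z where z: "\<And>n. Q n (z n)" "\<And>n. top (z n) + \<rho> (Suc n) \<le> low (z (Suc n))"
    using dependent_nat_choice[of Q "\<lambda>n z z'. top z + \<rho> (Suc n) \<le> low z'"] ex by metis
  have lt: "low (z n) \<le> top (z n)" for n by (simp add: low_def top_def)
  have later: "top (z k) + \<rho> m \<le> low (z m)" if "k < m" for k m
    using that
  proof (induction m)
    case (Suc j)
    show ?case
    proof (cases "k = j")
      case True then show ?thesis using z(2) by simp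
    next
      case False
      then have "top (z k) + \<rho> j \<le> low (z j)" using Suc by simp
      then show ?thesis using z(2)[of j] lt[of j] \<rho>(2)[of j] by simp
    qed
  qed simp
  have bnd: "dist a (fst (z n)) \<le> top (z n)" "dist a (snd (z n)) \<le> top (z n)"
    "low (z n) \<le> dist a (fst (z n))" "low (z n) \<le> dist a (snd (z n))" for n
    by (auto simp: top_def low_def)
  have "\<rho> n \<le> dist (snd (z m)) (fst (z n))" for m n
  proof (cases m n rule: linorder_cases)
    case less
    then show ?thesis
      using later[OF less] bnd(2)[of m] bnd(3)[of n] dist_triangle[of a "fst (z n)" "snd (z m)"] by simp
  next
    case equal
    then show ?thesis using z(1)[of n] by (simp add: Q_def dist_commute)
  next
    case greater
    then show ?thesis
      using later[OF greater] bnd(1)[of n] bnd(4)[of m] dist_triangle[of a "snd (z m)" "fst (z n)"]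
        monoD[OF \<rho>(1), of n m] by (simp add: dist_commute)
  qed
  moreover have "real n < dist a (fst (z n))" for n
    using z(1)[of n] bnd(3)[of n] by (simp add: Q_def)
  moreover have "P n (fst (z n)) (snd (z n))" for n using z(1)[of n] by (simp add: Q_def)
  ultimately show thesis using that[of "\<lambda>n. fst (z n)" "\<lambda>n. snd (z n)"] by blast
qed

text \<open>A supremum instead of a sum: it inherits common Lipschitz bounds without any disjointness of
  the supports.\<close>

definition tents :: "(nat \<Rightarrow> 'a::metric_space) \<Rightarrow> (nat \<Rightarrow> real) \<Rightarrow> 'a \<Rightarrow> real" where
  "tents p \<rho> x = (SUP n. tent (p n) (\<rho> n) x)"

context
  fixes p :: "nat \<Rightarrow> 'a::metric_space" and \<rho> :: "nat \<Rightarrow> real"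
  assumes \<rho>: "\<And>n. 1 \<le> \<rho> n"
begin

lemma rho_pos: "0 < \<rho> n" using \<rho>[of n] by simp

lemma tents_upper: "tent (p n) (\<rho> n) x \<le> tents p \<rho> x"
  unfolding tents_def by (intro cSUP_upper bdd_aboveI[of _ 1]) (auto simp: tent_le_1 rho_pos)

lemma tents_least: "(\<And>n. tent (p n) (\<rho> n) x \<le> u) \<Longrightarrow> tents p \<rho> x \<le> u"
  unfolding tents_def by (rule cSUP_least) auto

lemma tents_le_1: "tents p \<rho> x \<le> 1"
  by (intro tents_least tent_le_1 rho_pos)

lemma tents_nonneg: "0 \<le> tents p \<rho> x"
  using tents_upper[of 0 x] tent_nonneg[of "p 0" "\<rho> 0" x] by linarith

lemma tents_centre: "tents p \<rho> (p n) = 1"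
  using tents_upper[of n "p n"] tents_le_1[of "p n"] by simp

lemma tents_eq_0: "(\<And>n. \<rho> n \<le> dist x (p n)) \<Longrightarrow> tents p \<rho> x = 0"
proof -
  assume far: "\<And>n. \<rho> n \<le> dist x (p n)"
  have "tent (p n) (\<rho> n) x = 0" for n using tent_eq_0_iff[OF rho_pos[of n]] far[of n] by blast
  then have "tents p \<rho> x \<le> 0" by (intro tents_least) simp
  then show ?thesis using tents_nonneg[of x] by simp
qed

lemma tents_diff:
  assumes "\<And>n. tent (p n) (\<rho> n) x \<le> tent (p n) (\<rho> n) x' + u"
  shows "tents p \<rho> x \<le> tents p \<rho> x' + u"
  using assms tents_upper[of _ x'] by (intro tents_least) (meson add_right_mono order_trans)

lemma tents_continuous: "continuous_on UNIV (tents p \<rho>)"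
proof -
  have "tents p \<rho> x \<le> tents p \<rho> x' + dist x x'" for x x'
  proof (rule tents_diff)
    fix n
    have "dist x x' / \<rho> n \<le> dist x x'"
      using \<rho>[of n] by (simp add: divide_le_eq mult_le_cancel_left1 less_le_trans)
    then show "tent (p n) (\<rho> n) x \<le> tent (p n) (\<rho> n) x' + dist x x'"
      using tent_lipschitz[OF rho_pos[of n], of "p n" x x'] by linarith
  qed
  then have "dist (tents p \<rho> x) (tents p \<rho> x') \<le> dist x x'" for x x'
    unfolding dist_real_def by (smt (verit) dist_commute)
  then show ?thesis unfolding continuous_on_iff by (meson order_le_less_trans)
qed

text \<open>Far out only the tents with large index are alive, and these have small slope.\<close>

lemma wide_tents_in_SO_bdd:
  assumes proper: "proper_metric TYPE('a)" and lim: "filterlim \<rho> at_top sequentially"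
  shows "tents p \<rho> \<in> SO_bdd"
proof -
  define a where "a = p 0"
  have "tents p \<rho> \<in> SO"
    unfolding SO_iff[OF proper, of _ a]
  proof (intro conjI allI impI tents_continuous)
    fix R e :: real assume R: "R > 0" "e > 0"
    obtain N where N: "\<And>n. N \<le> n \<Longrightarrow> R / e \<le> \<rho> n"
      using lim unfolding filterlim_at_top eventually_sequentially by blast
    have "bdd_above ((\<lambda>n. dist a (p n) + \<rho> n + R) ` {..<N})" by (intro bdd_above_finite) auto
    then obtain M where M: "\<And>n. n < N \<Longrightarrow> dist a (p n) + \<rho> n + R \<le> M" unfolding bdd_above_def by auto
    have one_side: "tents p \<rho> x \<le> tents p \<rho> x' + e" if x: "M - R < dist a x" "dist x x' \<le> R" for x x'
    proof (rule tents_diff)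
      fix n
      show "tent (p n) (\<rho> n) x \<le> tent (p n) (\<rho> n) x' + e"
      proof (cases "n < N")
        case True
        then have "\<rho> n \<le> dist x (p n)"
          using M[OF True] x dist_triangle[of a x "p n"] by (simp add: dist_commute)
        then have "tent (p n) (\<rho> n) x = 0" by (simp add: tent_eq_0_iff rho_pos)
        then show ?thesis using R tent_nonneg[of "p n" "\<rho> n" x'] by simp
      next
        case False
        then have "R \<le> e * \<rho> n" using N[of n] R by (simp add: field_simps)
        then have "dist x x' / \<rho> n \<le> e" using x rho_pos[of n] by (simp add: divide_le_eq)
        then show ?thesis using tent_lipschitz[OF rho_pos[of n], of "p n" x x'] by simp
      qed
    qed
    show "\<exists>M. \<forall>x x'. M < dist a x \<longrightarrow> dist x x' \<le> R \<longrightarrow> \<bar>tents p \<rho> x - tents p \<rho> x'\<bar> \<le> e"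
    proof (intro exI allI impI)
      fix x x' assume x: "M < dist a x" "dist x x' \<le> R"
      then have "M - R < dist a x'" using dist_triangle[of a x x'] by (simp add: dist_commute)
      then show "\<bar>tents p \<rho> x - tents p \<rho> x'\<bar> \<le> e"
        using one_side[of x x'] one_side[of x' x] x R by (simp add: dist_commute abs_le_iff)
    qed
  qed
  moreover have "\<bar>tents p \<rho> x\<bar> \<le> 1" for x using tents_nonneg[of x] tents_le_1[of x] by simp
  ultimately show ?thesis unfolding SO_bdd_iff by blast
qed

end

text \<open>Any relation that holds for arbitrarily remote pairs at arbitrarily large mutual distance is
  witnessed by a sequence of pairs along which a bounded slowly oscillating function jumps from
  \<open>1\<close> to \<open>0\<close>.\<close>

lemma separating_function:
  fixes a :: "'a::metric_space"
  assumes proper: "proper_metric TYPE('a)"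
    and far: "\<And>n M. \<exists>x x'. M < dist a x \<and> M < dist a x' \<and> real n + 1 \<le> dist x x' \<and> P n x x'"
  obtains u p q where "u \<in> SO_bdd" "\<And>n. P n (p n) (q n)" "\<And>n. real n < dist a (p n)"
    "\<And>n. u (p n) = 1" "\<And>n. u (q n) = 0"
proof -
  let ?\<rho> = "\<lambda>n. real n + 1"
  have "mono ?\<rho>" by (simp add: mono_def)
  from sparse_pairs[OF far this] obtain p q where pq: "\<And>n. P n (p n) (q n)"
    "\<And>n. real n < dist a (p n)" "\<And>m n. ?\<rho> n \<le> dist (q m) (p n)" by auto
  have lim: "filterlim ?\<rho> at_top sequentially"
    by (rule filterlim_at_top_mono[OF filterlim_real_sequentially]) simp
  have ge1: "1 \<le> ?\<rho> n" for n by simp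
  show thesis
    using that[of "tents p ?\<rho>" p q] wide_tents_in_SO_bdd[of ?\<rho>, OF ge1 proper lim] pq
      tents_centre[of ?\<rho>, OF ge1] tents_eq_0[of ?\<rho>, OF ge1] by blast
qed


section \<open>Functionals that come from a lattice isomorphism\<close>

lemma linear_lattice_isoD:
  assumes "linear_lattice_iso A B T"
  shows "bij_betw T A B"
    and "f \<in> A \<Longrightarrow> g \<in> A \<Longrightarrow> T (\<lambda>x. f x + g x) = (\<lambda>y. T f y + T g y)"
    and "f \<in> A \<Longrightarrow> T (\<lambda>x. c * f x) = (\<lambda>y. c * T f y)"
    and "f \<in> A \<Longrightarrow> g \<in> A \<Longrightarrow> T (\<lambda>x. max (f x) (g x)) = (\<lambda>y. max (T f y) (T g y))"
    and "f \<in> A \<Longrightarrow> g \<in> A \<Longrightarrow> T (\<lambda>x. min (f x) (g x)) = (\<lambda>y. min (T f y) (T g y))"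
  using assms unfolding linear_lattice_iso_def by blast+

lemma linear_lattice_iso_inv:
  fixes A :: "('a::metric_space \<Rightarrow> real) set"
  assumes T: "linear_lattice_iso A B T" and "function_lattice A"
  shows "linear_lattice_iso B A (inv_into A T)"
proof -
  interpret function_lattice A by fact
  note iso = linear_lattice_isoD[OF T]
  let ?S = "inv_into A T"
  have S: "?S g \<in> A" "T (?S g) = g" if "g \<in> B" for g
    using iso(1) that by (auto simp: bij_betw_def inv_into_into f_inv_into_f)
  have ST: "?S (T f) = f" if "f \<in> A" for f
    using iso(1) that by (auto simp: bij_betw_def inv_into_f_f)
  show ?thesis
    unfolding linear_lattice_iso_def
  proof (intro conjI ballI allI)
    show "bij_betw ?S B A" by (rule bij_betw_inv_into[OF iso(1)])
    fix f g c assume f: "f \<in> B"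
    show "?S (\<lambda>x. c * f x) = (\<lambda>y. c * ?S f y)"
      using ST[OF scale[OF S(1)[OF f], of c]] iso(3)[OF S(1)[OF f]] S(2)[OF f] by simp
    assume g: "g \<in> B"
    note Sf = S(1)[OF f] and Sg = S(1)[OF g]
    show "?S (\<lambda>x. f x + g x) = (\<lambda>y. ?S f y + ?S g y)"
      using ST[OF add[OF Sf Sg]] iso(2)[OF Sf Sg] S(2)[OF f] S(2)[OF g] by simp
    show "?S (\<lambda>x. max (f x) (g x)) = (\<lambda>y. max (?S f y) (?S g y))"
      using ST[OF max[OF Sf Sg]] iso(4)[OF Sf Sg] S(2)[OF f] S(2)[OF g] by simp
    show "?S (\<lambda>x. min (f x) (g x)) = (\<lambda>y. min (?S f y) (?S g y))"
      using ST[OF min[OF Sf Sg]] iso(5)[OF Sf Sg] S(2)[OF f] S(2)[OF g] by simp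
  qed
qed

lemma lattice_functional_of_iso:
  fixes A :: "('a::metric_space \<Rightarrow> real) set"
  assumes "linear_lattice_iso A B T" "function_lattice A"
  shows "lattice_functional A (\<lambda>f. T f y)"
proof -
  interpret function_lattice A by fact
  show ?thesis
    by unfold_locales (simp_all add: linear_lattice_isoD[OF assms(1)])
qed

lemma SO_iso_is_point_evaluation:
  fixes T :: "('a::metric_space \<Rightarrow> real) \<Rightarrow> ('b::metric_space \<Rightarrow> real)"
  assumes "proper_metric TYPE('a)" "proper_metric TYPE('b)" and T: "linear_lattice_iso SO SO T"
  shows "\<exists>x c. \<forall>f\<in>SO. T f y = c * f x"
proof -
  interpret Y: function_lattice "SO :: ('b \<Rightarrow> real) set" by (rule function_lattice_SO[OF assms(2)])
  obtain h where "h \<in> SO" "T h = (\<lambda>_. 1)"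
    using linear_lattice_isoD(1)[OF T] Y.one unfolding bij_betw_def by (metis imageE)
  then show ?thesis
    using SO_functional_is_point_evaluation[OF assms(1) lattice_functional_of_iso[OF T function_lattice_SO[OF assms(1)]], of h y]
    by simp
qed

text \<open>Suppose that \<open>\<phi> f = T f y\<close> annihilates the tents. The preimages \<open>F n\<close> of narrowing tents at
  \<open>y\<close> satisfy \<open>\<phi> (F n) = 1\<close>, so they stay above a constant \<open>c\<close> at points arbitrarily far out. Take \<open>u\<close>
  that is \<open>1\<close> and \<open>0\<close> along two sequences of such points. The function \<open>s = \<bar>u - l\<bar>\<close> with
  \<open>l = \<phi> u / \<phi> 1\<close> is in the kernel, so \<open>T s\<close> is small near \<open>y\<close>; hence, for large \<open>n\<close>, \<open>min (T s) (T (F n))\<close>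
  is small everywhere, and so is \<open>min s (F n)\<close>. But \<open>s\<close> is at least \<open>1/2\<close> along one of the two
  sequences, where \<open>F n > c\<close>.\<close>

lemma SO_bdd_iso_is_point_evaluation:
  fixes T :: "('a::metric_space \<Rightarrow> real) \<Rightarrow> ('b::metric_space \<Rightarrow> real)"
  assumes properX: "proper_metric TYPE('a)" and properY: "proper_metric TYPE('b)"
    and T: "linear_lattice_iso SO_bdd SO_bdd T"
  shows "\<exists>x c. \<forall>f\<in>SO_bdd. T f y = c * f x"
proof (rule ccontr)
  assume not_point: "\<not> ?thesis"
  define \<phi> where "\<phi> f = T f y" for f
  interpret lattice_functional SO_bdd \<phi>
    unfolding \<phi>_def[abs_def] by (rule lattice_functional_of_iso[OF T function_lattice_SO_bdd[OF properX]])
  interpret Y: function_lattice "SO_bdd :: ('b \<Rightarrow> real) set" by (rule function_lattice_SO_bdd[OF properY])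
  note iso = linear_lattice_isoD[OF T]
  let ?S = "inv_into SO_bdd T"
  have S: "?S g \<in> SO_bdd" "T (?S g) = g" if "g \<in> SO_bdd" for g
    using iso(1) that by (auto simp: bij_betw_def inv_into_into f_inv_into_f)
  have ST: "?S (T f) = f" if "f \<in> SO_bdd" for f
    using iso(1) that by (auto simp: bij_betw_def inv_into_f_f)
  have T_in: "T f \<in> SO_bdd" if "f \<in> SO_bdd" for f using iso(1) that by (auto simp: bij_betw_def)
  define a :: 'a where "a = undefined"
  have tent0: "\<phi> (tent a r) = 0" if "r > 0" for r
    using tent_null_if_not_point_evaluation[OF properX tent_in_SO_bdd[OF properX that] that] not_point
    by (simp add: \<phi>_def)
  define k where "k n = tent y (1 / (real n + 1))" for n
  have k_in: "k n \<in> SO_bdd" for n unfolding k_def by (intro tent_in_SO_bdd properY) simp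
  define F where "F n = ?S (k n)" for n
  have F: "F n \<in> SO_bdd" "T (F n) = k n" "\<phi> (F n) = 1" for n
    using S[OF k_in[of n]] by (simp_all add: F_def \<phi>_def k_def)
  have "\<exists>B>0. \<forall>x. F n x \<le> B" for n
  proof -
    obtain B where B: "\<And>x. \<bar>F n x\<bar> \<le> B" using F(1)[of n] unfolding SO_bdd_iff by blast
    have "F n x \<le> \<bar>B\<bar> + 1" for x using B[of x] by linarith
    then show ?thesis by (intro exI[of _ "\<bar>B\<bar> + 1"]) auto
  qed
  then obtain B where B: "\<And>n. B n > 0" "\<And>n x. F n x \<le> B n" by metis
  have "1 \<le> B 0 * \<phi> (\<lambda>_. 1)"
    using functional_mono[OF F(1)[of 0] const[of "B 0"] B(2)] F(3)[of 0] functional_const[of "B 0"] by simp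
  then have phi1: "\<phi> (\<lambda>_. 1) > 0"
    using B(1)[of 0] by (smt (verit) mult_nonneg_nonpos)
  define c where "c = 1 / (2 * \<phi> (\<lambda>_. 1))"
  have c: "c > 0" using phi1 by (simp add: c_def)
  have far: "\<exists>x. M < dist a x \<and> c < F n x" for M n
  proof (rule ccontr)
    assume none: "\<not> ?thesis"
    define r where "r = 2 * max 1 M"
    have r: "r > 0" by (simp add: r_def)
    note tent_in = tent_in_SO_bdd[OF properX r, of a]
    have "F n x \<le> c + 2 * B n * tent a r x" for x
    proof (cases "M < dist a x")
      case True
      then have "F n x \<le> c" using none by (meson not_less)
      moreover have "0 \<le> 2 * B n * tent a r x" using B(1)[of n] by simp
      ultimately show ?thesis by linarith
    next
      case False
      then have "1/2 \<le> tent a r x" using r by (simp add: tent_def r_def dist_commute field_simps max_def)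
      then have "B n * 1 \<le> B n * (2 * tent a r x)" using B(1)[of n] by (intro mult_left_mono) auto
      then show ?thesis using B(2)[of n x] c by (simp add: algebra_simps)
    qed
    then have "\<phi> (F n) \<le> \<phi> (\<lambda>x. c + 2 * B n * tent a r x)" by (intro functional_mono F add const scale tent_in)
    also have "\<dots> = c * \<phi> (\<lambda>_. 1)"
      using functional_add[OF const scale[OF tent_in]] functional_scale[OF tent_in] tent0[OF r] functional_const[of c] by simp
    also have "\<dots> = 1/2" using phi1 by (simp add: c_def)
    finally show False using F(3)[of n] by simp
  qed
  have pairs: "\<exists>x x'. M < dist a x \<and> M < dist a x' \<and> real n + 1 \<le> dist x x' \<and> (c < F n x \<and> c < F n x')" for n M
  proof -
    obtain x where x: "M < dist a x" "c < F n x" using far by blast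
    obtain x' where x': "max M (dist a x + real n + 1) < dist a x'" "c < F n x'" using far by blast
    moreover have "dist a x' \<le> dist a x + dist x x'" by (rule dist_triangle)
    ultimately show ?thesis using x by (intro exI[of _ x] exI[of _ x']) auto
  qed
  obtain u p q where u: "u \<in> SO_bdd" "\<And>n. c < F n (p n) \<and> c < F n (q n)" "\<And>n. u (p n) = 1" "\<And>n. u (q n) = 0"
    using separating_function[OF properX pairs] by metis
  define l where "l = \<phi> u / \<phi> (\<lambda>_. 1)"
  define s where "s x = \<bar>u x - l\<bar>" for x
  have s_in: "s \<in> SO_bdd" unfolding s_def[abs_def] by (intro abs diff u const)
  have "\<phi> s = 0"
    unfolding s_def[abs_def] using phi1 functional_abs[OF diff[OF u(1) const[of l]]] functional_diff[OF u(1) const[of l]] functional_const[of l]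
    by (simp add: l_def)
  then have Ts0: "T s y = 0" by (simp add: \<phi>_def)
  obtain C where C: "\<And>x. \<bar>?S (\<lambda>_. 1) x\<bar> \<le> C" using S(1)[OF Y.one] unfolding SO_bdd_iff by blast
  \<comment> \<open>Since \<open>T\<^sup>-\<^sup>1 1 \<le> C\<close>, the bound \<open>T m \<le> \<epsilon>\<close> will give \<open>m \<le> \<epsilon> C\<close>, which this choice makes less
    than \<open>min (1/2) c\<close>.\<close>
  define \<epsilon> where "\<epsilon> = min (1/2) c / (2 * (\<bar>C\<bar> + 1))"
  have eps: "\<epsilon> > 0" using c by (simp add: \<epsilon>_def)
  have "isCont (T s) y" using Y.cont[OF T_in[OF s_in]] by (simp add: continuous_on_eq_continuous_at)
  then obtain \<delta> where delta: "\<delta> > 0" "\<And>z. dist z y < \<delta> \<Longrightarrow> \<bar>T s z\<bar> < \<epsilon>"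
    using eps Ts0 unfolding continuous_at_eps_delta by (metis diff_zero dist_real_def)
  obtain n :: nat where n: "1 / (real n + 1) < \<delta>"
    using nat_approx_posE[OF delta(1)] unfolding of_nat_Suc by (metis add.commute)
  have "min (T s z) (k n z) \<le> \<epsilon> * 1" for z
  proof (cases "dist z y < \<delta>")
    case True
    then show ?thesis using delta(2)[OF True] by linarith
  next
    case False
    then have "k n z = 0" unfolding k_def using n by (subst tent_eq_0_iff) auto
    then show ?thesis using eps by simp
  qed
  moreover
  define m where "m x = min (s x) (F n x)" for x
  define e where "e x = \<epsilon> * ?S (\<lambda>_. 1) x" for x
  have m_in: "m \<in> SO_bdd" unfolding m_def[abs_def] by (rule min[OF s_in F(1)])
  have e_in: "e \<in> SO_bdd" unfolding e_def[abs_def] by (rule scale[OF S(1)[OF Y.one]])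
  have "T m = (\<lambda>z. min (T s z) (k n z))" unfolding m_def[abs_def] iso(5)[OF s_in F(1)] F(2) ..
  moreover have "T e = (\<lambda>z. \<epsilon> * 1)" unfolding e_def[abs_def] iso(3)[OF S(1)[OF Y.one]] S(2)[OF Y.one] ..
  ultimately have "T (\<lambda>x. max (m x) (e x)) = T e"
    unfolding iso(4)[OF m_in e_in] by (simp add: max_absorb2)
  then have "(\<lambda>x. max (m x) (e x)) = e" using ST[OF max[OF m_in e_in]] ST[OF e_in] by simp
  then have le: "min (s x) (F n x) \<le> \<epsilon> * ?S (\<lambda>_. 1) x" for x
    unfolding m_def e_def by (metis max.cobounded1)
  have small: "min (s x) (F n x) < min (1/2) c" for x
  proof -
    have "\<epsilon> * ?S (\<lambda>_. 1) x \<le> \<epsilon> * (\<bar>C\<bar> + 1)" using eps C[of x] by (intro mult_left_mono) auto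
    also have "\<dots> = min (1/2) c / 2"
      unfolding \<epsilon>_def using abs_ge_zero[of C] by (simp add: field_simps)
    also have "\<dots> < min (1/2) c" using c by (simp add: min_def)
    finally show ?thesis using le[of x] by simp
  qed
  show False
    using small[of "p n"] small[of "q n"] u(2,3,4)[of n] c by (auto simp: s_def min_def split: if_splits)
qed

section \<open>Weighted composition operators\<close>

text \<open>Tents detect closeness: \<open>\<sigma> z\<close> is within \<open>e\<close> of \<open>\<sigma> y\<close> as soon as the tent of width \<open>e\<close> at
  \<open>\<sigma> y\<close> does not vanish at \<open>\<sigma> z\<close>.\<close>

lemma continuous_if_composition_continuous:
  fixes \<sigma> :: "'b::metric_space \<Rightarrow> 'a::metric_space"
  assumes proper: "proper_metric TYPE('a)"
    and comp: "\<And>f. f \<in> SO_bdd \<Longrightarrow> continuous_on UNIV (\<lambda>y. f (\<sigma> y))"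
  shows "continuous_on UNIV \<sigma>"
  unfolding continuous_on_iff
proof (intro ballI allI impI)
  fix y :: 'b and e :: real assume e: "e > 0"
  have "continuous_on UNIV (\<lambda>z. tent (\<sigma> y) e (\<sigma> z))" by (intro comp tent_in_SO_bdd proper e)
  then obtain d where d: "d > 0" "\<And>z. dist z y < d \<Longrightarrow> \<bar>tent (\<sigma> y) e (\<sigma> z) - 1\<bar> < 1"
    unfolding continuous_on_iff using zero_less_one[where 'a=real]
    by (metis UNIV_I dist_real_def tent_centre)
  have "dist (\<sigma> z) (\<sigma> y) < e" if "dist z y < d" for z
    using d(2)[OF that] tent_eq_0_iff[OF e, of "\<sigma> y" "\<sigma> z"] by (cases "e \<le> dist (\<sigma> z) (\<sigma> y)") auto
  then show "\<exists>d>0. \<forall>z\<in>UNIV. dist z y < d \<longrightarrow> dist (\<sigma> z) (\<sigma> y) < e" using d(1) by blast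
qed

lemma weighted_composition:
  fixes T :: "('a::metric_space \<Rightarrow> real) \<Rightarrow> ('b::metric_space \<Rightarrow> real)"
  assumes proper: "proper_metric TYPE('a)" and A: "function_lattice A" "SO_bdd \<subseteq> A"
    and B: "function_lattice B"
    and T: "linear_lattice_iso A B T"
    and point: "\<And>y. \<exists>x c. \<forall>f\<in>A. T f y = c * f x"
  obtains \<sigma> where "continuous_on UNIV \<sigma>" "\<And>y. T (\<lambda>_. 1) y > 0"
    "\<And>f y. f \<in> A \<Longrightarrow> T f y = T (\<lambda>_. 1) y * f (\<sigma> y)"
proof -
  interpret A: function_lattice A by fact
  interpret B: function_lattice B by fact
  note iso = linear_lattice_isoD[OF T]
  obtain \<sigma> c where c: "\<And>y f. f \<in> A \<Longrightarrow> T f y = c y * f (\<sigma> y)" using point by metis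
  have one: "T (\<lambda>_. 1) y = c y" for y using c[OF A.one] by simp
  have pos: "c y > 0" for y
  proof -
    interpret lattice_functional A "\<lambda>f. T f y" by (rule lattice_functional_of_iso[OF T A(1)])
    have "0 \<le> T (\<lambda>_. 1) y" using functional_mono[OF A.const[of 0] A.one] functional_const[of 0] by simp
    moreover obtain g where "g \<in> A" "T g = (\<lambda>_. 1)"
      using iso(1) B.one unfolding bij_betw_def by (metis imageE)
    then have "c y \<noteq> 0" using c[of g y] by auto
    ultimately show ?thesis using \<open>T (\<lambda>_. 1) y = c y\<close> by simp
  qed
  have "continuous_on UNIV \<sigma>"
  proof (rule continuous_if_composition_continuous[OF proper])
    fix f :: "'a \<Rightarrow> real" assume "f \<in> SO_bdd"
    then have f: "f \<in> A" using A(2) by blast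
    have T_in: "T h \<in> B" if "h \<in> A" for h using iso(1) that by (auto simp: bij_betw_def)
    have "continuous_on UNIV (\<lambda>y. T f y / T (\<lambda>_. 1) y)"
      using B.cont[OF T_in[OF f]] B.cont[OF T_in[OF A.one]] pos one
      by (intro continuous_on_divide) (auto simp: less_imp_neq[symmetric])
    moreover have "T f y / T (\<lambda>_. 1) y = f (\<sigma> y)" for y using c[OF f, of y] one pos[of y] by simp
    ultimately show "continuous_on UNIV (\<lambda>y. f (\<sigma> y))" by simp
  qed
  then show thesis using that c pos one by simp
qed

section \<open>The coarse structure\<close>

lemma vanishing_at_infinity_compose_in_SO_bdd:
  fixes \<tau> :: "'a::metric_space \<Rightarrow> 'b::metric_space" and h :: "'b \<Rightarrow> real"
  assumes proper: "proper_metric TYPE('a)" "proper_metric TYPE('b)"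
    and \<tau>: "continuous_on UNIV \<tau>" and \<sigma>: "continuous_on UNIV \<sigma>" "\<And>x. \<sigma> (\<tau> x) = x"
    and h: "continuous_on UNIV h"
    and small: "\<And>e. e > 0 \<Longrightarrow> \<exists>M. \<forall>y. M < dist b y \<longrightarrow> \<bar>h y\<bar> \<le> e"
  shows "(\<lambda>x. h (\<tau> x)) \<in> SO_bdd"
proof (rule vanishing_at_infinity_in_SO_bdd[OF proper(1)])
  show "continuous_on UNIV (\<lambda>x. h (\<tau> x))" by (rule continuous_on_compose2[OF h \<tau>]) auto
  fix e :: real assume "e > 0"
  then obtain M where M: "\<And>y. M < dist b y \<Longrightarrow> \<bar>h y\<bar> \<le> e" using small by blast
  obtain Q where Q: "\<And>y. dist b y \<le> M \<Longrightarrow> dist undefined (\<sigma> y) \<le> Q"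
    using proper_bounded_image[OF proper(2) \<sigma>(1)] by blast
  have "M < dist b (\<tau> x)" if "Q < dist undefined x" for x
    using Q[of "\<tau> x"] \<sigma>(2)[of x] that by (cases "dist b (\<tau> x) \<le> M") auto
  then show "\<exists>M. \<forall>x. M < dist undefined x \<longrightarrow> \<bar>h (\<tau> x)\<bar> \<le> e" using M by blast
qed

lemma unbounded_far_point:
  fixes a :: "'a::metric_space"
  assumes "unbounded_metric TYPE('a)"
  obtains x where "M < dist a x"
proof -
  have "\<not> (\<forall>x\<in>UNIV. dist a x \<le> M)"
    using assms unfolding unbounded_metric_def bounded_any_center[where a=a] by blast
  then show thesis using that by (auto simp: not_le)
qed

text \<open>Along points \<open>y n\<close> with \<open>\<omega> (y n) > n\<close>, place tents of width \<open>1\<close> and divide by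
  \<open>sqrt (1 + \<omega>)\<close>. As \<open>\<omega>\<close> barely changes on unit balls far out, the quotient \<open>h\<close> vanishes at infinity,
  but \<open>\<omega> h\<close> is about \<open>sqrt (\<omega> (y n))\<close> at \<open>y n\<close>. By chain-connectedness \<open>y n\<close> has a point \<open>z n\<close> outside
  the tent but at bounded distance, where \<open>\<omega> h\<close> is zero; so \<open>\<omega> h\<close> does not oscillate slowly.\<close>

lemma bounded_weight:
  fixes \<omega> :: "'b::metric_space \<Rightarrow> real"
  assumes proper: "proper_metric TYPE('b)" and unb: "unbounded_metric TYPE('b)"
    and chain: "chain_connected TYPE('b)"
    and \<omega>: "\<omega> \<in> SO" "\<And>y. \<omega> y > 0"
    and mult: "\<And>h b. continuous_on UNIV h \<Longrightarrow>
      (\<And>e. e > 0 \<Longrightarrow> \<exists>M. \<forall>y. M < dist b y \<longrightarrow> \<bar>h y\<bar> \<le> e) \<Longrightarrow> (\<lambda>y. \<omega> y * h y) \<in> SO"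
  shows "\<exists>C. \<forall>y. \<omega> y \<le> C"
proof (rule ccontr)
  assume "\<not> ?thesis"
  then have big: "\<exists>y. C < \<omega> y" for C by (auto simp: not_le)
  obtain r where r: "r > 0" "r_chain_connected r TYPE('b)" using chain by (auto simp: chain_connected_def)
  define b :: 'b where "b = undefined"
  have neighbour: "\<exists>z. 1 \<le> dist y z \<and> dist y z \<le> r + 1" for y :: 'b
  proof -
    obtain x where x: "1 < dist y x" using unbounded_far_point[OF unb] by blast
    obtain n :: nat and p where p: "p 0 = y" "p n = x" "\<And>i. i \<in> {1..n} \<Longrightarrow> dist (p (i - 1)) (p i) \<le> r"
      using r(2) unfolding r_chain_connected_def by metis
    \<comment> \<open>The first point outside the unit ball of a chain that leads away from \<open>y\<close>.\<close>
    define i where "i = (LEAST i. 1 \<le> dist y (p i))"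
    have "1 \<le> dist y (p n)" using x p by simp
    then have i: "1 \<le> dist y (p i)" "i \<le> n" unfolding i_def by (rule LeastI, rule Least_le)
    have "i \<noteq> 0"
    proof
      assume "i = 0"
      then show False using i(1) p(1) by simp
    qed
    then have "dist y (p (i - 1)) < 1" using not_less_Least[of "i - 1" "\<lambda>i. 1 \<le> dist y (p i)"] by (simp add: i_def)
    moreover have "dist (p (i - 1)) (p i) \<le> r" using p(3) i \<open>i \<noteq> 0\<close> by simp
    ultimately have "dist y (p i) \<le> r + 1" using dist_triangle[of y "p i" "p (i - 1)"] by simp
    then show ?thesis using i by blast
  qed
  have pairs: "\<exists>y z. M < dist b y \<and> M < dist b z \<and> (1::real) \<le> dist y z \<and> (real n < \<omega> y \<and> dist y z \<le> r + 1)" for n M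
  proof -
    obtain Q where Q: "\<And>y. dist b y \<le> M + r + 1 \<Longrightarrow> \<bar>\<omega> y\<bar> \<le> Q"
      using proper_bounded_real[OF proper SO_continuous[OF \<omega>(1)]] by blast
    obtain y where y: "max Q (real n) < \<omega> y" using big by blast
    then have "M + r + 1 < dist b y" using Q[of y] by fastforce
    moreover obtain z where "1 \<le> dist y z" "dist y z \<le> r + 1" using neighbour by blast
    moreover have "dist b y \<le> dist b z + dist y z" using dist_triangle[of b y z] by (simp add: dist_commute)
    ultimately show ?thesis using y r(1) by (intro exI[of _ y] exI[of _ z]) auto
  qed
  have mono1: "mono (\<lambda>_::nat. 1::real)" by (simp add: mono_def)
  obtain y z where yz: "\<And>n. real n < \<omega> (y n) \<and> dist (y n) (z n) \<le> r + 1" "\<And>n. real n < dist b (y n)"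
    "\<And>m n. 1 \<le> dist (z m) (y n)"
    by (rule sparse_pairs[where a = b and \<rho> = "\<lambda>_. 1" and P = "\<lambda>n y z. real n < \<omega> y \<and> dist y z \<le> r + 1", OF pairs mono1])
      (simp, blast)
  let ?u = "tents y (\<lambda>_. 1)"
  define h where "h x = ?u x / sqrt (1 + \<omega> x)" for x
  have pos: "0 < sqrt (1 + \<omega> x)" for x using \<omega>(2)[of x] by simp
  have "continuous_on UNIV h"
    unfolding h_def[abs_def] using pos
    by (intro continuous_on_divide tents_continuous continuous_intros SO_continuous[OF \<omega>(1)])
      (auto simp: less_imp_neq[symmetric])
  moreover have "\<exists>M. \<forall>x. M < dist b x \<longrightarrow> \<bar>h x\<bar> \<le> e" if e: "e > 0" for e
  proof -
    obtain M1 where M1: "\<And>x x'. M1 < dist b x \<Longrightarrow> dist x x' \<le> 1 \<Longrightarrow> \<bar>\<omega> x - \<omega> x'\<bar> \<le> 1"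
      using SO_osc[OF proper \<omega>(1) zero_less_one zero_less_one] by blast
    obtain N where N: "1 / e^2 \<le> real N" using real_arch_simple by blast
    have "bdd_above ((\<lambda>n. dist b (y n) + 1) ` {..<N})" by (intro bdd_above_finite) auto
    then obtain M2 where M2: "\<And>n. n < N \<Longrightarrow> dist b (y n) + 1 \<le> M2" unfolding bdd_above_def by auto
    have "\<bar>h x\<bar> \<le> e" if x: "max M1 M2 < dist b x" for x
    proof (cases "\<exists>n. dist x (y n) < 1")
      case False
      then have "?u x = 0" by (intro tents_eq_0) (auto simp: not_less)
      then show ?thesis using e by (simp add: h_def)
    next
      case True
      then obtain n where n: "dist x (y n) < 1" by blast
      have "dist b x \<le> dist b (y n) + dist x (y n)" using dist_triangle[of b x "y n"] by (simp add: dist_commute)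
      then have "N \<le> n" using M2[of n] x n by (cases "n < N") auto
      moreover have "\<bar>\<omega> x - \<omega> (y n)\<bar> \<le> 1" using M1[of x "y n"] x n by simp
      ultimately have "1 / e^2 \<le> 1 + \<omega> x" using N yz(1)[of n] by linarith
      then have "sqrt (1 / e^2) \<le> sqrt (1 + \<omega> x)" by (rule real_sqrt_le_mono)
      then have "1 \<le> e * sqrt (1 + \<omega> x)" using e by (simp add: real_sqrt_divide field_simps)
      moreover have "?u x \<le> 1" "0 \<le> ?u x" by (auto intro: tents_le_1 tents_nonneg)
      ultimately have "?u x \<le> e * sqrt (1 + \<omega> x)" by linarith
      then have "h x \<le> e" using pos[of x] by (simp add: h_def pos_divide_le_eq)
      moreover have "0 \<le> h x" using pos[of x] \<open>0 \<le> ?u x\<close> by (simp add: h_def)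
      ultimately show ?thesis by simp
    qed
    then show ?thesis by blast
  qed
  ultimately have "(\<lambda>x. \<omega> x * h x) \<in> SO" by (rule mult)
  moreover have "r + 1 > 0" using r by simp
  ultimately obtain M where M: "\<And>x x'. M < dist b x \<Longrightarrow> dist x x' \<le> r + 1 \<Longrightarrow> \<bar>\<omega> x * h x - \<omega> x' * h x'\<bar> \<le> 1"
    using SO_osc[OF proper _ _ zero_less_one] by blast
  obtain n where n: "max M 2 \<le> real n" using real_arch_simple by blast
  have "h (z n) = 0" "h (y n) = 1 / sqrt (1 + \<omega> (y n))"
    using yz(3) by (auto simp: h_def tents_centre tents_eq_0)
  then have "\<omega> (y n) / sqrt (1 + \<omega> (y n)) \<le> 1" using M[of "y n" "z n"] yz(1,2)[of n] n by auto
  then have "\<omega> (y n) \<le> sqrt (1 + \<omega> (y n))" using pos[of "y n"] by (simp add: divide_le_eq)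
  then have "(\<omega> (y n))^2 \<le> 1 + \<omega> (y n)" using \<omega>(2)[of "y n"] by (simp add: real_le_rsqrt sqrt_ge_absD)
  moreover have "2 * \<omega> (y n) \<le> (\<omega> (y n))^2"
    using yz(1)[of n] n by (simp add: power2_eq_square)
  ultimately show False using yz(1)[of n] n by auto
qed

text \<open>The least possible control function is the supremum of the image distances.\<close>

lemma uniformly_expansiveI:
  assumes bnd: "\<And>R. \<exists>S. \<forall>x x'. dist x x' \<le> R \<longrightarrow> dist (f x) (f x') \<le> S"
  shows "uniformly_expansive f"
proof -
  define D where "D t = {dist (f x) (f x') | x x'. dist x x' \<le> t}" for t
  have bdd: "bdd_above (D t)" for t using bnd[of t] by (auto simp: D_def bdd_above_def)
  have ne: "0 \<in> D t" if "t \<ge> 0" for t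
    unfolding D_def using that by (auto intro!: exI[of _ undefined])
  have "mono_on {0..} (\<lambda>t. Sup (D t))"
  proof (rule mono_onI)
    fix s t :: real assume "s \<in> {0..}" "s \<le> t"
    then show "Sup (D s) \<le> Sup (D t)"
    proof (intro cSup_subset_mono bdd)
      show "D s \<noteq> {}" using ne[of s] \<open>s \<in> {0..}\<close> by auto
      show "D s \<subseteq> D t" unfolding D_def using order_trans[OF _ \<open>s \<le> t\<close>] by blast
    qed
  qed
  moreover have "Sup (D t) \<ge> 0" if "t \<ge> 0" for t by (intro cSup_upper bdd ne that)
  moreover have "dist (f x) (f x') \<le> Sup (D (dist x x'))" for x x'
    by (intro cSup_upper bdd) (auto simp: D_def)
  ultimately show ?thesis unfolding uniformly_expansive_def by blast
qed

text \<open>If \<open>\<tau>\<close> is not uniformly expansive, there are pairs in the target that drift apart while their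
  preimages stay within \<open>R\<close>. Both points of a pair can be taken outside a given ball: were one of
  them inside, the preimages of both, and hence both points, would stay in a fixed ball. A function
  separating the pairs pulls back to one that jumps by at least \<open>c\<close> within distance \<open>R\<close>.\<close>

lemma uniformly_expansive_if_weighted_composition:
  fixes \<tau> :: "'a::metric_space \<Rightarrow> 'b::metric_space"
  assumes proper: "proper_metric TYPE('a)" "proper_metric TYPE('b)"
    and \<tau>: "continuous_on UNIV \<tau>" and \<sigma>: "continuous_on UNIV \<sigma>" "\<And>x. \<sigma> (\<tau> x) = x" "\<And>y. \<tau> (\<sigma> y) = y"
    and w: "c > 0" "\<And>x. c \<le> w x"
    and comp: "\<And>g. g \<in> SO_bdd \<Longrightarrow> (\<lambda>x. w x * g (\<tau> x)) \<in> SO"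
  shows "uniformly_expansive \<tau>"
proof (rule uniformly_expansiveI, rule ccontr)
  fix R assume "\<not> (\<exists>S. \<forall>x x'. dist x x' \<le> R \<longrightarrow> dist (\<tau> x) (\<tau> x') \<le> S)"
  then have bad: "\<exists>x x'. dist x x' \<le> R \<and> S < dist (\<tau> x) (\<tau> x')" for S by (meson not_le)
  define a :: 'a where "a = undefined"
  define b :: 'b where "b = undefined"
  have pairs: "\<exists>y y'. M < dist b y \<and> M < dist b y' \<and> real n + 1 \<le> dist y y' \<and> dist (\<sigma> y) (\<sigma> y') \<le> R" for n M
  proof -
    obtain Q where Q: "\<And>y. dist b y \<le> M \<Longrightarrow> dist a (\<sigma> y) \<le> Q"
      using proper_bounded_image[OF proper(2) \<sigma>(1)] by blast
    obtain Q' where Q': "\<And>x. dist a x \<le> Q + R \<Longrightarrow> dist b (\<tau> x) \<le> Q'"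
      using proper_bounded_image[OF proper(1) \<tau>] by blast
    obtain x x' where x: "dist x x' \<le> R" "max (real n + 1) (M + Q') < dist (\<tau> x) (\<tau> x')" using bad by blast
    have out: "M < dist b (\<tau> x)" if x: "dist x x' \<le> R" "M + Q' < dist (\<tau> x) (\<tau> x')" for x x'
    proof (rule ccontr)
      assume "\<not> M < dist b (\<tau> x)"
      then have "dist a x \<le> Q" using Q[of "\<tau> x"] \<sigma> by simp
      then have "dist a x' \<le> Q + R" using x dist_triangle[of a x' x] by simp
      then have "dist b (\<tau> x') \<le> Q'" by (rule Q')
      then show False using x \<open>\<not> M < dist b (\<tau> x)\<close> dist_triangle3[of "\<tau> x" "\<tau> x'" b] by simp
    qed
    show ?thesis
      using x out[of x x'] out[of x' x] \<sigma> by (intro exI[of _ "\<tau> x"] exI[of _ "\<tau> x'"]) (auto simp: dist_commute)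
  qed
  obtain u p q where u: "u \<in> SO_bdd" "\<And>n. dist (\<sigma> (p n)) (\<sigma> (q n)) \<le> R" "\<And>n. real n < dist b (p n)"
    "\<And>n. u (p n) = 1" "\<And>n. u (q n) = 0"
    using separating_function[OF proper(2) pairs] by metis
  have "max R 1 > 0" "c / 2 > 0" using w by auto
  then obtain M where M: "\<And>x x'. M < dist a x \<Longrightarrow> dist x x' \<le> max R 1 \<Longrightarrow> \<bar>w x * u (\<tau> x) - w x' * u (\<tau> x')\<bar> \<le> c / 2"
    using SO_osc[OF proper(1) comp[OF u(1)]] by blast
  obtain Q where Q: "\<And>x. dist a x \<le> M \<Longrightarrow> dist b (\<tau> x) \<le> Q"
    using proper_bounded_image[OF proper(1) \<tau>] by blast
  obtain n where n: "Q \<le> real n" using real_arch_simple by blast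
  have "M < dist a (\<sigma> (p n))"
    using Q[of "\<sigma> (p n)"] u(3)[of n] n \<sigma>(3)[of "p n"] by (cases "dist a (\<sigma> (p n)) \<le> M") auto
  then have "\<bar>w (\<sigma> (p n))\<bar> \<le> c / 2"
    using M[of "\<sigma> (p n)" "\<sigma> (q n)"] u(2,4,5)[of n] \<sigma>(3) by simp
  then show False using w(1) w(2)[of "\<sigma> (p n)"] by linarith
qed

lemma metrically_proper_if_continuous_inverse:
  fixes \<tau> :: "'a::metric_space \<Rightarrow> 'b::metric_space"
  assumes "proper_metric TYPE('b)" "continuous_on UNIV \<sigma>" "\<And>x. \<sigma> (\<tau> x) = x"
  shows "metrically_proper \<tau>"
  unfolding metrically_proper_def
proof (intro allI impI)
  fix S :: "'b set" assume "bounded S"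
  then obtain M where M: "\<And>y. y \<in> S \<Longrightarrow> dist undefined y \<le> M"
    unfolding bounded_any_center[where a=undefined] by blast
  obtain Q where "\<And>y. dist undefined y \<le> M \<Longrightarrow> dist undefined (\<sigma> y) \<le> Q"
    using proper_bounded_image[OF assms(1,2)] by blast
  then have "dist undefined x \<le> Q" if "x \<in> \<tau> -` S" for x using M[of "\<tau> x"] that assms(3)[of x] by force
  then show "bounded (\<tau> -` S)" unfolding bounded_any_center[where a=undefined] by blast
qed

lemma SO_compose:
  fixes h :: "'b::metric_space \<Rightarrow> 'a::metric_space"
  assumes proper: "proper_metric TYPE('a)" "proper_metric TYPE('b)"
    and h: "continuous_on UNIV h" "coarse_map h" and f: "f \<in> SO"
  shows "(\<lambda>y. f (h y)) \<in> SO"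
proof -
  define a :: 'a where "a = undefined"
  define b :: 'b where "b = undefined"
  obtain \<sigma> where \<sigma>: "mono_on {0..} \<sigma>" "\<And>t. t \<ge> 0 \<Longrightarrow> \<sigma> t \<ge> 0" "\<And>y y'. dist (h y) (h y') \<le> \<sigma> (dist y y')"
    using h unfolding coarse_map_def uniformly_expansive_def by blast
  show ?thesis
    unfolding SO_iff[OF proper(2), of _ b]
  proof (intro conjI allI impI)
    show "continuous_on UNIV (\<lambda>y. f (h y))"
      by (rule continuous_on_compose2[OF SO_continuous[OF f] h(1)]) auto
    fix R e :: real assume R: "R > 0" "e > 0"
    have "\<sigma> R + 1 > 0" using \<sigma>(2)[of R] R by simp
    then obtain M where M: "\<And>x x'. M < dist a x \<Longrightarrow> dist x x' \<le> \<sigma> R + 1 \<Longrightarrow> \<bar>f x - f x'\<bar> \<le> e"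
      using SO_osc[OF proper(1) f _ R(2)] by blast
    have "bounded (h -` cball a M)"
      using h by (simp add: coarse_map_def metrically_proper_def)
    then obtain Q where Q: "\<And>y. dist a (h y) \<le> M \<Longrightarrow> dist b y \<le> Q"
      unfolding bounded_any_center[where a=b] by (metis mem_cball vimageI)
    have "\<bar>f (h y) - f (h y')\<bar> \<le> e" if "Q < dist b y" "dist y y' \<le> R" for y y'
    proof (rule M)
      show "M < dist a (h y)" using Q[of y] that by force
      have "\<sigma> (dist y y') \<le> \<sigma> R" using \<sigma>(1) that R by (auto simp: mono_on_def)
      then show "dist (h y) (h y') \<le> \<sigma> R + 1" using \<sigma>(3)[of y y'] by simp
    qed
    then show "\<exists>M. \<forall>y y'. M < dist b y \<longrightarrow> dist y y' \<le> R \<longrightarrow> \<bar>f (h y) - f (h y')\<bar> \<le> e" by blast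
  qed
qed

lemma SO_bdd_compose:
  fixes h :: "'b::metric_space \<Rightarrow> 'a::metric_space"
  assumes "proper_metric TYPE('a)" "proper_metric TYPE('b)"
    and "continuous_on UNIV h" "coarse_map h" and "f \<in> SO_bdd"
  shows "(\<lambda>y. f (h y)) \<in> SO_bdd"
  using SO_compose[OF assms(1-4)] assms(5) unfolding SO_bdd_iff by blast

section \<open>Isomorphisms between lattices of slowly oscillating functions\<close>

text \<open>If \<open>\<tau>' x = \<tau> x'\<close> with \<open>x' \<noteq> x\<close>, a tent at \<open>x'\<close> that vanishes near \<open>x\<close> lies below \<open>0\<close> near \<open>x\<close>, but
  its image is positive at \<open>\<tau>' x\<close>.\<close>

lemma induced_homeomorphism_unique:
  fixes T :: "('a::metric_space \<Rightarrow> real) \<Rightarrow> ('b::metric_space \<Rightarrow> real)"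
  assumes proper: "proper_metric TYPE('a)" and A: "function_lattice A" "SO_bdd \<subseteq> A"
    and \<tau>: "continuous_on UNIV \<sigma>" "\<And>x. \<sigma> (\<tau> x) = x" "\<And>y. \<tau> (\<sigma> y) = y"
    and w: "\<And>y. w y > 0" "\<And>f y. f \<in> A \<Longrightarrow> T f y = w y * f (\<sigma> y)"
    and ind: "induced_homeomorphism A T \<tau>'"
  shows "\<tau>' = \<tau>"
proof (rule ccontr)
  assume "\<tau>' \<noteq> \<tau>"
  then obtain x where "\<tau>' x \<noteq> \<tau> x" by blast
  define x' where "x' = \<sigma> (\<tau>' x)"
  have "x' \<noteq> x" using \<open>\<tau>' x \<noteq> \<tau> x\<close> \<tau>(3)[of "\<tau>' x"] by (auto simp: x'_def)
  interpret function_lattice A by fact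
  define r where "r = dist x x' / 2"
  have r: "r > 0" using \<open>x' \<noteq> x\<close> by (simp add: r_def)
  define f where "f = tent x' r"
  have f: "f \<in> A" using A(2) tent_in_SO_bdd[OF proper r] by (auto simp: f_def)
  have "\<forall>z\<in>ball x r. f z \<le> 0"
  proof
    fix z assume "z \<in> ball x r"
    then have "r \<le> dist z x'" using dist_triangle[of x x' z] by (simp add: r_def field_simps)
    then show "f z \<le> 0" using tent_eq_0_iff[OF r, of x' z] by (simp add: f_def)
  qed
  then have "\<forall>y\<in>\<tau>' ` ball x r. T f y \<le> T (\<lambda>_. 0) y"
    using ind f const[of 0] unfolding induced_homeomorphism_def by (metis open_ball)
  then have "T f (\<tau>' x) \<le> T (\<lambda>_. 0) (\<tau>' x)" using r by auto
  then show False
    using w(2)[OF f, of "\<tau>' x"] w(2)[OF const[of 0], of "\<tau>' x"] w(1)[of "\<tau>' x"] by (simp add: f_def x'_def)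
qed

text \<open>The part of the argument that is the same for both lattices. It treats \<open>T\<close> and its inverse
  symmetrically; what depends on the lattice enters through the four last hypotheses: functionals
  of both maps are multiples of point evaluations, and composition with a continuous coarse map
  carries one lattice into the other.\<close>

lemma iso_between_SO_lattices:
  fixes T :: "('a::metric_space \<Rightarrow> real) \<Rightarrow> ('b::metric_space \<Rightarrow> real)"
  assumes X: "proper_metric TYPE('a)" "unbounded_metric TYPE('a)" "chain_connected TYPE('a)"
    and Y: "proper_metric TYPE('b)" "unbounded_metric TYPE('b)" "chain_connected TYPE('b)"
    and A: "function_lattice A" "SO_bdd \<subseteq> A" "A \<subseteq> SO"
    and B: "function_lattice B" "SO_bdd \<subseteq> B" "B \<subseteq> SO"
    and T: "linear_lattice_iso A B T"
    and pointT: "\<And>y. \<exists>x c. \<forall>f\<in>A. T f y = c * f x"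
    and pointS: "\<And>x. \<exists>y c. \<forall>g\<in>B. inv_into A T g x = c * g y"
    and compA: "\<And>(h :: 'b \<Rightarrow> 'a) f. continuous_on UNIV h \<Longrightarrow> coarse_map h \<Longrightarrow> f \<in> A \<Longrightarrow> (\<lambda>y. f (h y)) \<in> B"
    and compB: "\<And>(h :: 'a \<Rightarrow> 'b) g. continuous_on UNIV h \<Longrightarrow> coarse_map h \<Longrightarrow> g \<in> B \<Longrightarrow> (\<lambda>x. g (h x)) \<in> A"
  shows "(\<exists>!\<tau>. induced_homeomorphism A T \<tau>) \<and>
    (\<forall>\<tau>. induced_homeomorphism A T \<tau> \<longrightarrow>
      coarse_homeomorphism \<tau> \<and> (\<forall>f\<in>A. T f = (\<lambda>y. T (\<lambda>_. 1) y * (f \<circ> inv \<tau>) y))) \<and>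
    T (\<lambda>_. 1) \<in> sharp B"
proof -
  interpret A: function_lattice A by fact
  interpret B: function_lattice B by fact
  define S where "S = inv_into A T"
  have Siso: "linear_lattice_iso B A S" unfolding S_def by (rule linear_lattice_iso_inv[OF T A(1)])
  have bij: "bij_betw T A B" by (rule linear_lattice_isoD[OF T])
  have T_in: "T f \<in> B" if "f \<in> A" for f using bij that by (auto simp: bij_betw_def)
  have S: "S g \<in> A" "T (S g) = g" if "g \<in> B" for g
    using bij that by (auto simp: S_def bij_betw_def inv_into_into f_inv_into_f)
  have ST: "S (T f) = f" if "f \<in> A" for f
    using bij that by (auto simp: S_def bij_betw_def inv_into_f_f)
  define w where "w = T (\<lambda>_. 1)"
  define v where "v = S (\<lambda>_. 1)"
  obtain \<sigma> where \<sigma>: "continuous_on UNIV \<sigma>" and w: "\<And>y. w y > 0" "\<And>f y. f \<in> A \<Longrightarrow> T f y = w y * f (\<sigma> y)"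
    using weighted_composition[OF X(1) A(1,2) B(1) T pointT] by (metis w_def)
  obtain \<tau> where \<tau>: "continuous_on UNIV \<tau>" and v: "\<And>x. v x > 0" "\<And>g x. g \<in> B \<Longrightarrow> S g x = v x * g (\<tau> x)"
    using weighted_composition[OF Y(1) B(1,2) A(1) Siso] pointS by (metis v_def S_def)
  have wv: "w y * v (\<sigma> y) = 1" for y
    using S(2)[OF B.one] w(2)[OF S(1)[OF B.one], of y] by (simp add: v_def)
  have vw: "v x * w (\<tau> x) = 1" for x
    using ST[OF A.one] v(2)[OF T_in[OF A.one], of x] by (simp add: w_def)
  \<comment> \<open>\<open>T (S g) = g\<close> reads \<open>g y = g (\<tau> (\<sigma> y))\<close>, and tents separate points.\<close>
  have \<tau>\<sigma>: "\<tau> (\<sigma> y) = y" for y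
  proof (rule ccontr)
    assume ne: "\<tau> (\<sigma> y) \<noteq> y"
    define g where "g = tent y (dist (\<tau> (\<sigma> y)) y)"
    have "g \<in> SO_bdd" unfolding g_def using ne by (intro tent_in_SO_bdd Y) simp
    then have g: "g \<in> B" using B by blast
    have "g y = w y * (v (\<sigma> y) * g (\<tau> (\<sigma> y)))"
      using S(2)[OF g] w(2)[OF S(1)[OF g], of y] v(2)[OF g] by simp
    moreover have "g (\<tau> (\<sigma> y)) = 0" unfolding g_def using ne by (subst tent_eq_0_iff) auto
    ultimately show False by (simp add: g_def)
  qed
  have \<sigma>\<tau>: "\<sigma> (\<tau> x) = x" for x
  proof (rule ccontr)
    assume ne: "\<sigma> (\<tau> x) \<noteq> x"
    define f where "f = tent x (dist (\<sigma> (\<tau> x)) x)"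
    have "f \<in> SO_bdd" unfolding f_def using ne by (intro tent_in_SO_bdd X) simp
    then have f: "f \<in> A" using A by blast
    have "f x = v x * (w (\<tau> x) * f (\<sigma> (\<tau> x)))"
      using ST[OF f] v(2)[OF T_in[OF f], of x] w(2)[OF f] by simp
    moreover have "f (\<sigma> (\<tau> x)) = 0" unfolding f_def using ne by (subst tent_eq_0_iff) auto
    ultimately show False by (simp add: f_def)
  qed
  have inv: "inv \<tau> = \<sigma>" using \<tau>\<sigma> \<sigma>\<tau> by (metis inv_equality)
  have homeo: "homeomorphism UNIV UNIV \<tau> (inv \<tau>)"
    unfolding inv homeomorphism_def using \<tau> \<sigma> \<tau>\<sigma> \<sigma>\<tau> by (metis UNIV_eq_I rangeI)
  have w_SO: "w \<in> SO" and v_SO: "v \<in> SO"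
    using T_in[OF A.one] S(1)[OF B.one] A B by (auto simp: w_def v_def)
  have mp_\<tau>: "metrically_proper \<tau>" by (rule metrically_proper_if_continuous_inverse[OF Y(1) \<sigma> \<sigma>\<tau>])
  have mp_\<sigma>: "metrically_proper \<sigma>" by (rule metrically_proper_if_continuous_inverse[OF X(1) \<tau> \<tau>\<sigma>])
  have "\<exists>C. \<forall>y. w y \<le> C"
  proof (rule bounded_weight[OF Y w_SO w(1)])
    fix h :: "'b \<Rightarrow> real" and b assume h: "continuous_on UNIV h" and small: "\<And>e. e > 0 \<Longrightarrow> \<exists>M. \<forall>y. M < dist b y \<longrightarrow> \<bar>h y\<bar> \<le> e"
    have "(\<lambda>x. h (\<tau> x)) \<in> SO_bdd"
      by (rule vanishing_at_infinity_compose_in_SO_bdd[OF X(1) Y(1) \<tau> \<sigma> \<sigma>\<tau> h small])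
    then have hA: "(\<lambda>x. h (\<tau> x)) \<in> A" using A by blast
    have "T (\<lambda>x. h (\<tau> x)) = (\<lambda>y. w y * h y)" using w(2)[OF hA] \<tau>\<sigma> by auto
    then show "(\<lambda>y. w y * h y) \<in> SO" using T_in[OF hA] B by auto
  qed
  then obtain C where C: "\<And>y. w y \<le> C" by blast
  have "\<exists>C. \<forall>x. v x \<le> C"
  proof (rule bounded_weight[OF X v_SO v(1)])
    fix h :: "'a \<Rightarrow> real" and a assume h: "continuous_on UNIV h" and small: "\<And>e. e > 0 \<Longrightarrow> \<exists>M. \<forall>x. M < dist a x \<longrightarrow> \<bar>h x\<bar> \<le> e"
    have "(\<lambda>y. h (\<sigma> y)) \<in> SO_bdd"
      by (rule vanishing_at_infinity_compose_in_SO_bdd[OF Y(1) X(1) \<sigma> \<tau> \<tau>\<sigma> h small])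
    then have hB: "(\<lambda>y. h (\<sigma> y)) \<in> B" using B by blast
    have "S (\<lambda>y. h (\<sigma> y)) = (\<lambda>x. v x * h x)" using v(2)[OF hB] \<sigma>\<tau> by auto
    then show "(\<lambda>x. v x * h x) \<in> SO" using S(1)[OF hB] A by auto
  qed
  then obtain D where D: "\<And>x. v x \<le> D" by blast
  have "C > 0" "D > 0" using C[of undefined] w(1)[of undefined] D[of undefined] v(1)[of undefined] by linarith+
  have v_low: "1 / C \<le> v x" for x
  proof -
    have "1 \<le> v x * C" using vw[of x] C[of "\<tau> x"] v(1)[of x] by (metis mult_left_mono less_imp_le)
    then show ?thesis using \<open>C > 0\<close> by (simp add: divide_le_eq)
  qed
  have w_low: "1 / D \<le> w y" for y
  proof -
    have "1 \<le> w y * D" using wv[of y] D[of "\<sigma> y"] w(1)[of y] by (metis mult_left_mono less_imp_le)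
    then show ?thesis using \<open>D > 0\<close> by (simp add: divide_le_eq)
  qed
  have "uniformly_expansive \<tau>"
  proof (rule uniformly_expansive_if_weighted_composition[OF X(1) Y(1) \<tau> \<sigma> \<sigma>\<tau> \<tau>\<sigma> _ v_low])
    fix g :: "'b \<Rightarrow> real" assume "g \<in> SO_bdd"
    then have g: "g \<in> B" using B by blast
    have "S g = (\<lambda>x. v x * g (\<tau> x))" using v(2)[OF g] by auto
    then show "(\<lambda>x. v x * g (\<tau> x)) \<in> SO" using S(1)[OF g] A by auto
  qed (use \<open>C > 0\<close> in simp)
  then have coarse_\<tau>: "coarse_map \<tau>" using mp_\<tau> by (simp add: coarse_map_def)
  have "uniformly_expansive \<sigma>"
  proof (rule uniformly_expansive_if_weighted_composition[OF Y(1) X(1) \<sigma> \<tau> \<tau>\<sigma> \<sigma>\<tau> _ w_low])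
    fix f :: "'a \<Rightarrow> real" assume "f \<in> SO_bdd"
    then have f: "f \<in> A" using A by blast
    have "T f = (\<lambda>y. w y * f (\<sigma> y))" using w(2)[OF f] by auto
    then show "(\<lambda>y. w y * f (\<sigma> y)) \<in> SO" using T_in[OF f] B by auto
  qed (use \<open>D > 0\<close> in simp)
  then have coarse_\<sigma>: "coarse_map \<sigma>" using mp_\<sigma> by (simp add: coarse_map_def)
  have "induced_homeomorphism A T \<tau>"
    unfolding induced_homeomorphism_def
    using homeo w \<sigma>\<tau> by (auto simp: mult_le_cancel_left_pos)
  moreover have uniq: "\<tau>' = \<tau>" if "induced_homeomorphism A T \<tau>'" for \<tau>'
    by (rule induced_homeomorphism_unique[OF X(1) A(1,2) \<sigma> \<sigma>\<tau> \<tau>\<sigma> w that])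
  moreover have "coarse_homeomorphism \<tau>"
    unfolding coarse_homeomorphism_def inv using homeo coarse_\<tau> coarse_\<sigma> by (simp add: inv)
  moreover have "T f = (\<lambda>y. w y * (f \<circ> inv \<tau>) y)" if "f \<in> A" for f
    using w(2)[OF that] by (auto simp: inv)
  moreover have "w \<in> sharp B"
    unfolding sharp_def
  proof (intro CollectI conjI allI ballI w(1))
    show "w \<in> B" using T_in[OF A.one] by (simp add: w_def)
    fix g assume g: "g \<in> B"
    have gA: "(\<lambda>x. g (\<tau> x)) \<in> A" by (rule compB[OF \<tau> coarse_\<tau> g])
    have "T (\<lambda>x. g (\<tau> x)) = (\<lambda>y. w y * g y)" using w(2)[OF gA] \<tau>\<sigma> by auto
    then show "(\<lambda>y. w y * g y) \<in> B" using T_in[OF gA] by simp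
    have "v (\<sigma> y) = 1 / w y" for y using wv[of y] w(1)[of y] by (simp add: field_simps)
    then have "S g (\<sigma> y) = 1 / w y * g y" for y using v(2)[OF g, of "\<sigma> y"] \<tau>\<sigma>[of y] by simp
    then show "(\<lambda>y. 1 / w y * g y) \<in> B" using compA[OF \<sigma> coarse_\<sigma> S(1)[OF g]] by simp
  qed
  ultimately show ?thesis unfolding w_def[symmetric] by (metis (full_types))
qed

theorem theorem4p10:
  fixes T :: "('a::metric_space \<Rightarrow> real) \<Rightarrow> ('b::metric_space \<Rightarrow> real)"
    and \<omega> :: "'b \<Rightarrow> real"
  assumes "proper_metric TYPE('a)" "unbounded_metric TYPE('a)" "chain_connected TYPE('a)"
    and "proper_metric TYPE('b)" "unbounded_metric TYPE('b)" "chain_connected TYPE('b)"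
    and "\<omega> = T (\<lambda>_. 1)"
  shows
    "(linear_lattice_iso SO SO T \<longrightarrow>
        (\<exists>!\<tau>. induced_homeomorphism SO T \<tau>) \<and>
        (\<forall>\<tau>. induced_homeomorphism SO T \<tau> \<longrightarrow>
           coarse_homeomorphism \<tau> \<and> (\<forall>f\<in>SO. T f = (\<lambda>y. \<omega> y * (f \<circ> inv \<tau>) y))) \<and>
        \<omega> \<in> sharp SO) \<and>
     (linear_lattice_iso SO_bdd SO_bdd T \<longrightarrow>
        (\<exists>!\<tau>. induced_homeomorphism SO_bdd T \<tau>) \<and>
        (\<forall>\<tau>. induced_homeomorphism SO_bdd T \<tau> \<longrightarrow>
           coarse_homeomorphism \<tau> \<and> (\<forall>f\<in>SO_bdd. T f = (\<lambda>y. \<omega> y * (f \<circ> inv \<tau>) y))) \<and>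
        \<omega> \<in> sharp SO_bdd)"
proof (rule conjI; rule impI)
  note X = assms(1-3) and Y = assms(4-6)
  {
    assume T: "linear_lattice_iso SO SO T"
    note T' = linear_lattice_iso_inv[OF T function_lattice_SO[OF X(1)]]
    show "(\<exists>!\<tau>. induced_homeomorphism SO T \<tau>) \<and>
        (\<forall>\<tau>. induced_homeomorphism SO T \<tau> \<longrightarrow>
           coarse_homeomorphism \<tau> \<and> (\<forall>f\<in>SO. T f = (\<lambda>y. \<omega> y * (f \<circ> inv \<tau>) y))) \<and>
        \<omega> \<in> sharp SO"
      unfolding assms(7)
      by (rule iso_between_SO_lattices[OF X Y function_lattice_SO[OF X(1)] SO_bdd_subset order_refl
          function_lattice_SO[OF Y(1)] SO_bdd_subset order_refl T
          SO_iso_is_point_evaluation[OF X(1) Y(1) T] SO_iso_is_point_evaluation[OF Y(1) X(1) T']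
          SO_compose[OF X(1) Y(1)] SO_compose[OF Y(1) X(1)]])
  next
    assume T: "linear_lattice_iso SO_bdd SO_bdd T"
    note T' = linear_lattice_iso_inv[OF T function_lattice_SO_bdd[OF X(1)]]
    show "(\<exists>!\<tau>. induced_homeomorphism SO_bdd T \<tau>) \<and>
        (\<forall>\<tau>. induced_homeomorphism SO_bdd T \<tau> \<longrightarrow>
           coarse_homeomorphism \<tau> \<and> (\<forall>f\<in>SO_bdd. T f = (\<lambda>y. \<omega> y * (f \<circ> inv \<tau>) y))) \<and>
        \<omega> \<in> sharp SO_bdd"
      unfolding assms(7)
      by (rule iso_between_SO_lattices[OF X Y function_lattice_SO_bdd[OF X(1)] order_refl SO_bdd_subset
          function_lattice_SO_bdd[OF Y(1)] order_refl SO_bdd_subset T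
          SO_bdd_iso_is_point_evaluation[OF X(1) Y(1) T] SO_bdd_iso_is_point_evaluation[OF Y(1) X(1) T']
          SO_bdd_compose[OF X(1) Y(1)] SO_bdd_compose[OF Y(1) X(1)]])
  }
qed

end
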